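(* Let $(A_n)_{n\in\mathbb Z}$ be a sequence of (not necessarily invertible) linear operators on $\mathbb R^d$. Suppose that the only bounded sequence $(x_n)_{n\le 0}\subset\mathbb R^d$ such that $x_0=0$ and $x_{n+1}=A_nx_n$ for all $n\le -1$ is the zero sequence, i.e. $x_n=0$ for all $n\le 0$. Then the following properties are equivalent: (a) the equation $x_{n+1}=A_nx_n$, $n\in\mathbb Z$, is Hyers-Ulam stable; (b) the equation $x_{n+1}=A_nx_n$, $n\in\mathbb Z$, admits an exponential trichotomy.
   Context: $\mathbb R^d$ carries some norm $|\cdot|$, and $\|\cdot\|$ is the associated operator norm. A solution of $x_{n+1}=A_nx_n$, $n\in\mathbb Z$, is a sequence $(x_n)_{n\in\mathbb Z}\subset\mathbb R^d$ satisfying this for all $n\in\mathbb Z$. For $m>n$ put $\mathcal A(m,n)=A_{m-1}\cdots A_n$, and $\mathcal A(n,n)=\mathrm{Id}$. Hyers-Ulam stability: the equation $x_{n+1}=A_nx_n$ is Hyers-Ulam stable if there is $L>0$ such that for each $\delta>0$ and each sequence $(y_n)_{n\in\mathbb Z}\subset\mathbb R^d$ with $\sup_{n\in\mathbb Z}|y_{n+1}-A_ny_n|\le\delta$ there is a solution $(x_n)_{n\in\mathbb Z}$ with $\sup_{n\in\mathbb Z}|x_n-y_n|\le L\delta$. Exponential dichotomy: let $J\in\{\mathbb Z,\mathbb Z^+,\mathbb Z^-\}$, where $\mathbb Z^+=\{n\in\mathbb Z: n\ge0\}$ and $\mathbb Z^-=\{n\in\mathbb Z: n\le 0\}$. The equation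 admits an exponential dichotomy on $J$ with respect to projections $P_n$, $n\in J$, on $\mathbb R^d$ if there are constants $D,\lambda>0$ such that: (i) for $n,n+1\in J$, $P_{n+1}A_n=A_nP_n$ and $A_n|_{\operatorname{Ker}P_n}:\operatorname{Ker}P_n\to\operatorname{Ker}P_{n+1}$ is invertible; (ii) $\|\mathcal A(m,n)P_n\|\le De^{-\lambda(m-n)}$ for $m,n\in J$, $m\ge n$; (iii) $\|\mathcal A(m,n)(\mathrm{Id}-P_n)\|\le De^{-\lambda(n-m)}$ for $m,n\in J$, $m\le n$, where for $m<n$ one sets $\mathcal A(m,n):=(\mathcal A(n,m)|_{\operatorname{Ker}P_m})^{-1}:\operatorname{Ker}P_n\to\operatorname{Ker}P_m$. Exponential trichotomy: the equation admits an exponential trichotomy if it admits an exponential dichotomy on $\mathbb Z^+$ with respect to some projections $P_n^+$, $n\in\mathbb Z^+$, and an exponential dichotomy on $\mathbb Z^-$ with respect to some projections $P_n^-$, $n\in\mathbb Z^-$, such that $P_0^-=P_0^-P_0^+=P_0^+P_0^-$. *)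

theory Defs
  imports "HOL-Analysis.Analysis"
begin

definition is_norm :: "('a::real_vector \<Rightarrow> real) \<Rightarrow> bool" where
  "is_norm N \<longleftrightarrow>
     (\<forall>x. 0 \<le> N x) \<and> (\<forall>x. N x = 0 \<longleftrightarrow> x = 0) \<and>
     (\<forall>c x. N (c *\<^sub>R x) = \<bar>c\<bar> * N x) \<and> (\<forall>x y. N (x + y) \<le> N x + N y)"

text \<open>The operator norm induced by \<open>N\<close>. The supremum is that of a nonempty bounded set whenever
  \<open>N\<close> is a norm and \<open>T\<close> is linear on a finite-dimensional space; \<open>T\<close> is always of this kind where
  \<open>op_norm\<close> is used below.\<close>

definition op_norm :: "('a::real_vector \<Rightarrow> real) \<Rightarrow> ('a \<Rightarrow> 'a) \<Rightarrow> real" where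
  "op_norm N T = Sup {N (T x) |x. N x \<le> 1}"

definition projection :: "('a::real_vector \<Rightarrow> 'a) \<Rightarrow> bool" where
  "projection P \<longleftrightarrow> linear P \<and> P \<circ> P = P"

definition Ker :: "('a::real_vector \<Rightarrow> 'a) \<Rightarrow> 'a set" where
  "Ker T = {x. T x = 0}"

definition is_solution :: "(int \<Rightarrow> 'a \<Rightarrow> 'a) \<Rightarrow> (int \<Rightarrow> 'a) \<Rightarrow> bool" where
  "is_solution A x \<longleftrightarrow> (\<forall>n. x (n + 1) = A n (x n))"

text \<open>Bounds on suprema over \<open>\<int>\<close> are written termwise, since \<open>Sup\<close> on \<open>real\<close> is unspecified for
  unbounded sets.\<close>

definition hyers_ulam_stable :: "('a::real_vector \<Rightarrow> real) \<Rightarrow> (int \<Rightarrow> 'a \<Rightarrow> 'a) \<Rightarrow> bool" where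
  "hyers_ulam_stable N A \<longleftrightarrow>
     (\<exists>L>0. \<forall>\<delta>>0. \<forall>y. (\<forall>n. N (y (n + 1) - A n (y n)) \<le> \<delta>) \<longrightarrow>
        (\<exists>x. is_solution A x \<and> (\<forall>n. N (x n - y n) \<le> L * \<delta>)))"

text \<open>\<open>cocycle_steps A n k\<close> is the product of the \<open>k\<close> operators \<open>A (n + k - 1), \<dots>, A n\<close>, that is,
  \<open>\<A>(n + k, n)\<close>.\<close>

primrec cocycle_steps :: "(int \<Rightarrow> 'a \<Rightarrow> 'a) \<Rightarrow> int \<Rightarrow> nat \<Rightarrow> 'a \<Rightarrow> 'a" where
  "cocycle_steps A n 0 = id"
| "cocycle_steps A n (Suc k) = A (n + int k) \<circ> cocycle_steps A n k"

text \<open>\<open>\<A>(m, n)\<close> for all pairs of times. For \<open>m < n\<close> it is the inverse of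
  \<open>\<A>(n, m)\<close> restricted to \<open>Ker (P m)\<close>, and hence meaningful only on \<open>Ker (P n)\<close>.\<close>

definition cocycle :: "(int \<Rightarrow> 'a::real_vector \<Rightarrow> 'a) \<Rightarrow> (int \<Rightarrow> 'a \<Rightarrow> 'a) \<Rightarrow> int \<Rightarrow> int \<Rightarrow> 'a \<Rightarrow> 'a" where
  "cocycle A P m n =
     (if n \<le> m then cocycle_steps A n (nat (m - n))
      else inv_into (Ker (P m)) (cocycle_steps A m (nat (n - m))))"

text \<open>The intended index sets \<open>J\<close> are \<open>UNIV\<close>, \<open>{0..}\<close> and \<open>{..0}\<close>. Values of \<open>P\<close> outside \<open>J\<close> are
  irrelevant.\<close>

definition exp_dichotomy ::
  "('a::real_vector \<Rightarrow> real) \<Rightarrow> (int \<Rightarrow> 'a \<Rightarrow> 'a) \<Rightarrow> int set \<Rightarrow> (int \<Rightarrow> 'a \<Rightarrow> 'a) \<Rightarrow> bool" where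
  "exp_dichotomy N A J P \<longleftrightarrow>
     (\<forall>n\<in>J. projection (P n)) \<and>
     (\<exists>D>0. \<exists>\<mu>>0.
        (\<forall>n. n \<in> J \<and> n + 1 \<in> J \<longrightarrow>
           P (n + 1) \<circ> A n = A n \<circ> P n \<and> bij_betw (A n) (Ker (P n)) (Ker (P (n + 1)))) \<and>
        (\<forall>m\<in>J. \<forall>n\<in>J. n \<le> m \<longrightarrow>
           op_norm N (cocycle A P m n \<circ> P n) \<le> D * exp (- \<mu> * real_of_int (m - n))) \<and>
        (\<forall>m\<in>J. \<forall>n\<in>J. m \<le> n \<longrightarrow>
           op_norm N (cocycle A P m n \<circ> (\<lambda>x. x - P n x)) \<le> D * exp (- \<mu> * real_of_int (n - m))))"

definition exp_trichotomy :: "('a::real_vector \<Rightarrow> real) \<Rightarrow> (int \<Rightarrow> 'a \<Rightarrow> 'a) \<Rightarrow> bool" where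
  "exp_trichotomy N A \<longleftrightarrow>
     (\<exists>Pp Pm. exp_dichotomy N A {0..} Pp \<and> exp_dichotomy N A {..0} Pm \<and>
        Pm 0 = Pm 0 \<circ> Pp 0 \<and> Pm 0 \<circ> Pp 0 = Pp 0 \<circ> Pm 0)"

end

(* All estimates go through the Green function G(m,n), equal to A(m,n) P_n for n <= m and to
   -A(m,n) (Id - P_n) for m < n.

   Given a trichotomy, sums of G on the two half-lines give bounded solutions of
   z_{n+1} = A_n z_n + w_n there, and the compatibility of P_0^+ and P_0^- allows gluing them at 0.

   Conversely, let S_n and U_n be the spaces of initial values at time n of bounded forward and
   backward orbits. Stability, applied to an error concentrated at one time, gives S_n + U_n = R^d.
   A complement U' <= U_0 of S_0 is transported forward to yield the kernels on the right half-line;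
   a complement S' <= S_0 of U_0 is pulled back to yield the ranges on the left half-line, where
   the hypothesis makes A_n injective on U_n. Stability bounds all sums of G(m,j) w_j uniformly,
   and the choice w_j = G(j,n) v turns this into exponential decay of G. *)

theory Submission
  imports Defs
begin

section \<open>Norms on a Euclidean space\<close>

text \<open>On the whole line bounded solutions need not be unique, because S_n and U_n may
  intersect nontrivially. On each half-line, fixing a complement at time 0 reduces the ambiguity to
  a homogeneous solution controlled by its value at 0; this is why two dichotomies appear instead of
  one. The inclusions U' <= U_0 and S' <= S_0 tie the two together: U' lies in the kernel of P_0^-
  and S' in the range of P_0^+, which is exactly the relation required between the projections at 0.

  Non-invertibility enters asymmetrically. The kernel of A_n always lies in S_n, so on the right A_n
  is automatically injective on a complement of S_n. On the left this kernel might meet U_n, and the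
  uniqueness hypothesis forbids it: a nonzero bounded backward orbit that is mapped to zero by time
  0 would extend to a nonzero bounded sequence with value 0 at time 0.\<close>

lemma is_normD:
  assumes "is_norm N"
  shows "0 \<le> N x" "N x = 0 \<longleftrightarrow> x = 0" "N (c *\<^sub>R x) = \<bar>c\<bar> * N x" "N (x + y) \<le> N x + N y"
  using assms unfolding is_norm_def by auto

lemma is_norm_zero: "is_norm N \<Longrightarrow> N 0 = 0"
  by (simp add: is_normD)

lemma is_norm_minus:
  assumes "is_norm N"
  shows "N (- x) = N x"
  using is_normD(3)[OF assms, of "-1" x] by simp

lemma is_norm_diff:
  assumes "is_norm N"
  shows "N (x - y) \<le> N x + N y"
  using is_normD(4)[OF assms, of x "- y"] by (simp add: is_norm_minus[OF assms])

lemma is_norm_sum: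
  assumes "is_norm N"
  shows "N (sum f F) \<le> (\<Sum>i\<in>F. N (f i))"
proof (induction F rule: infinite_finite_induct)
  case (insert x F)
  then show ?case
    using is_normD(4)[OF assms, of "f x" "sum f F"] by simp
qed (simp_all add: is_norm_zero[OF assms])

lemma is_norm_le_norm:
  fixes N :: "'a::euclidean_space \<Rightarrow> real"
  assumes "is_norm N"
  obtains c where "c > 0" "\<And>x. N x \<le> c * norm x"
proof
  let ?c = "(\<Sum>b\<in>Basis. N b) + 1"
  have nn: "0 \<le> (\<Sum>b\<in>Basis. N b)"
    by (intro sum_nonneg is_normD(1)[OF assms])
  show "?c > 0"
    using nn by linarith
  show "N x \<le> ?c * norm x" for x
  proof -
    have "N x = N (\<Sum>b\<in>Basis. (x \<bullet> b) *\<^sub>R b)"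
      by (simp add: euclidean_representation)
    also have "\<dots> \<le> (\<Sum>b\<in>Basis. N ((x \<bullet> b) *\<^sub>R b))"
      by (rule is_norm_sum[OF assms])
    also have "\<dots> \<le> (\<Sum>b\<in>Basis. norm x * N b)"
      by (intro sum_mono) (auto simp: is_normD(3)[OF assms] Basis_le_norm
          intro!: mult_right_mono is_normD(1)[OF assms])
    also have "\<dots> = norm x * (\<Sum>b\<in>Basis. N b)"
      by (simp add: sum_distrib_left)
    finally show ?thesis
      using norm_ge_zero[of x] by (simp only: distrib_right mult.commute[of _ "norm x"] distrib_left)
  qed
qed

lemma continuous_on_is_norm:
  fixes N :: "'a::euclidean_space \<Rightarrow> real"
  assumes "is_norm N"
  shows "continuous_on S N"
proof -
  obtain c where c: "c > 0" "\<And>x. N x \<le> c * norm x"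
    using is_norm_le_norm[OF assms] by blast
  have "\<bar>N x - N y\<bar> \<le> c * norm (x - y)" for x y
    using is_normD(4)[OF assms, of "x - y" y] is_normD(4)[OF assms, of "y - x" x]
      c(2)[of "x - y"] c(2)[of "y - x"] by (simp add: norm_minus_commute)
  then have "c-lipschitz_on S N"
    using c(1) by (intro lipschitz_onI) (auto simp: dist_norm)
  then show ?thesis
    by (rule lipschitz_on_continuous_on)
qed

lemma norm_le_is_norm:
  fixes N :: "'a::euclidean_space \<Rightarrow> real"
  assumes "is_norm N"
  obtains c where "c > 0" "\<And>x. norm x \<le> c * N x"
proof -
  have "compact (sphere (0::'a) 1)" "sphere (0::'a) 1 \<noteq> {}"
    by auto
  then obtain u where u: "u \<in> sphere 0 1" "\<And>x. x \<in> sphere 0 1 \<Longrightarrow> N u \<le> N x"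
    using continuous_attains_inf[OF _ _ continuous_on_is_norm[OF assms]] by metis
  have "u \<noteq> 0"
    using u(1) by auto
  then have pos: "N u > 0"
    using is_normD(1,2)[OF assms, of u] by linarith
  have "norm x \<le> (1 / N u) * N x" for x
  proof (cases "x = 0")
    case False
    then have "N u \<le> N ((1 / norm x) *\<^sub>R x)"
      by (intro u(2)) auto
    then show ?thesis
      using False pos by (simp add: is_normD(3)[OF assms] field_simps)
  qed (simp add: is_norm_zero[OF assms])
  then show ?thesis
    using pos that[of "1 / N u"] by simp
qed

section \<open>Uniform bounds for linear families and the operator norm\<close>

text \<open>Uniform boundedness in finite dimension: pointwise bounds at the finitely many basis
  vectors already control the whole family. This is how constants independent of time arise from
  bounds on single orbits.\<close>

lemma linear_family_bounded:
  fixes N :: "'a::euclidean_space \<Rightarrow> real"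
  assumes N: "is_norm N"
    and lin: "\<And>i. i \<in> I \<Longrightarrow> linear (T i)"
    and bdd: "\<And>v. \<exists>M. \<forall>i\<in>I. N (T i v) \<le> M"
  obtains C where "C > 0" "\<And>i v. i \<in> I \<Longrightarrow> N (T i v) \<le> C * N v"
proof -
  obtain M where M: "\<And>v i. i \<in> I \<Longrightarrow> N (T i v) \<le> M v"
    using bdd by metis
  obtain c where c: "c > 0" "\<And>x. norm x \<le> c * N x"
    using norm_le_is_norm[OF N] by blast
  let ?B = "(\<Sum>b\<in>Basis. \<bar>M b\<bar>) + 1"
  have nn: "0 \<le> (\<Sum>b\<in>Basis. \<bar>M b\<bar>)"
    by (intro sum_nonneg) auto
  have "N (T i v) \<le> (?B * c) * N v" if i: "i \<in> I" for i v
  proof -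
    have "T i v = T i (\<Sum>b\<in>Basis. (v \<bullet> b) *\<^sub>R b)"
      by (simp add: euclidean_representation)
    also have "\<dots> = (\<Sum>b\<in>Basis. (v \<bullet> b) *\<^sub>R T i b)"
      using lin[OF i] by (simp add: linear_sum linear_scale)
    finally have "N (T i v) \<le> (\<Sum>b\<in>Basis. N ((v \<bullet> b) *\<^sub>R T i b))"
      using is_norm_sum[OF N] by metis
    also have "\<dots> \<le> (\<Sum>b\<in>Basis. norm v * \<bar>M b\<bar>)"
      using M[OF i] by (intro sum_mono) (auto simp: is_normD(3)[OF N] Basis_le_norm
          intro!: mult_mono is_normD(1)[OF N] order_trans[OF M[OF i]])
    also have "\<dots> = norm v * (\<Sum>b\<in>Basis. \<bar>M b\<bar>)"
      by (simp add: sum_distrib_left)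
    also have "\<dots> \<le> norm v * ?B"
      by (intro mult_left_mono) auto
    also have "\<dots> \<le> (c * N v) * ?B"
      using nn by (intro mult_right_mono c(2)) linarith
    finally show ?thesis
      by (simp add: mult_ac)
  qed
  moreover have "?B * c > 0"
    using nn c(1) by (simp add: add_nonneg_pos)
  ultimately show ?thesis
    using that by blast
qed

lemma op_norm_le:
  assumes N: "is_norm N" and "0 \<le> c" and T: "\<And>v. N (T v) \<le> c * N v"
  shows "op_norm N T \<le> c"
  unfolding op_norm_def
proof (rule cSup_least)
  show "{N (T x) |x. N x \<le> 1} \<noteq> {}"
    using is_norm_zero[OF N] by (auto intro!: exI[of _ 0])
next
  fix r assume "r \<in> {N (T x) |x. N x \<le> 1}"
  then obtain x where x: "r = N (T x)" "N x \<le> 1"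
    by auto
  have "c * N x \<le> c * 1"
    using x(2) \<open>0 \<le> c\<close> by (intro mult_left_mono)
  then show "r \<le> c"
    using T[of x] x(1) by simp
qed

lemma le_op_norm:
  fixes N :: "'a::euclidean_space \<Rightarrow> real"
  assumes N: "is_norm N" and T: "linear T"
  shows "N (T v) \<le> op_norm N T * N v"
proof (cases "v = 0")
  case True
  then show ?thesis
    using is_norm_zero[OF N] linear_0[OF T] by simp
next
  case False
  then have pos: "N v > 0"
    using is_normD(1,2)[OF N, of v] by linarith
  \<comment> \<open>A family with one member. The bound makes the supremum in \<open>op_norm\<close>
    a genuine least upper bound.\<close>
  obtain C where C: "C > 0" "\<And>v. N (T v) \<le> C * N v"
    using linear_family_bounded[OF N, of "{()}" "\<lambda>_. T"] T by auto
  have "bdd_above {N (T x) |x. N x \<le> 1}"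
  proof (rule bdd_aboveI)
    fix r assume "r \<in> {N (T x) |x. N x \<le> 1}"
    then obtain x where x: "r = N (T x)" "N x \<le> 1"
      by auto
    have "C * N x \<le> C * 1"
      using x(2) C(1) by (intro mult_left_mono) auto
    then show "r \<le> C"
      using C(2)[of x] x(1) by simp
  qed
  moreover have "N ((1 / N v) *\<^sub>R v) \<le> 1"
    using pos by (simp add: is_normD(3)[OF N])
  ultimately have "N (T ((1 / N v) *\<^sub>R v)) \<le> op_norm N T"
    unfolding op_norm_def by (intro cSup_upper) auto
  then show ?thesis
    using pos by (simp add: linear_scale[OF T] is_normD(3)[OF N] field_simps)
qed

section \<open>Complementary subspaces\<close>

definition complementary :: "'a::real_vector set \<Rightarrow> 'a set \<Rightarrow> bool" where
  "complementary S U \<longleftrightarrow>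
     subspace S \<and> subspace U \<and> S \<inter> U = {0} \<and> (\<forall>v. \<exists>s\<in>S. v - s \<in> U)"

definition proj_along :: "'a::real_vector set \<Rightarrow> 'a set \<Rightarrow> 'a \<Rightarrow> 'a" where
  "proj_along S U v = (THE s. s \<in> S \<and> v - s \<in> U)"

lemma proj_along_eqI:
  assumes "complementary S U" "s \<in> S" "v - s \<in> U"
  shows "proj_along S U v = s"
  unfolding proj_along_def
proof (rule the_equality)
  fix t assume t: "t \<in> S \<and> v - t \<in> U"
  have "t - s \<in> S" "(v - s) - (v - t) \<in> U"
    using assms t unfolding complementary_def by (blast intro: subspace_diff)+
  then have "t - s \<in> S \<inter> U"
    by simp
  then show "t = s"
    using assms(1) unfolding complementary_def by auto
qed (use assms in auto)

lemma proj_along_mem: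
  assumes "complementary S U"
  shows "proj_along S U v \<in> S" "v - proj_along S U v \<in> U"
proof -
  obtain s where "s \<in> S" "v - s \<in> U"
    using assms unfolding complementary_def by blast
  then show "proj_along S U v \<in> S" "v - proj_along S U v \<in> U"
    using proj_along_eqI[OF assms] by simp_all
qed

lemma proj_along_fixed_iff:
  assumes "complementary S U"
  shows "proj_along S U v = v \<longleftrightarrow> v \<in> S"
  using proj_along_mem(1)[OF assms, of v] proj_along_eqI[OF assms, of v v] assms
  by (auto simp: complementary_def subspace_0)

lemma Ker_proj_along:
  assumes "complementary S U"
  shows "Ker (proj_along S U) = U"
proof -
  have "0 \<in> S"
    using assms by (simp add: complementary_def subspace_0)
  then have "proj_along S U v = 0 \<longleftrightarrow> v \<in> U" for v
    using proj_along_mem(2)[OF assms, of v] proj_along_eqI[OF assms, of 0 v] by auto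
  then show ?thesis
    by (simp add: Ker_def)
qed

lemma projection_proj_along:
  assumes c: "complementary S U"
  shows "projection (proj_along S U)"
  unfolding projection_def
proof
  have sub: "subspace S" "subspace U"
    using c by (auto simp: complementary_def)
  note mem = proj_along_mem[OF c]
  show "linear (proj_along S U)"
  proof (rule linearI)
    fix x y :: 'a and r :: real
    have "(x - proj_along S U x) + (y - proj_along S U y) \<in> U"
      using sub mem by (intro subspace_add)
    then show "proj_along S U (x + y) = proj_along S U x + proj_along S U y"
      using sub mem by (intro proj_along_eqI[OF c] subspace_add) (simp_all add: algebra_simps)
    have "r *\<^sub>R (x - proj_along S U x) \<in> U"
      using sub mem by (intro subspace_scale)
    then show "proj_along S U (r *\<^sub>R x) = r *\<^sub>R proj_along S U x"
      using sub mem by (intro proj_along_eqI[OF c] subspace_scale) (simp_all add: algebra_simps)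
  qed
  show "proj_along S U \<circ> proj_along S U = proj_along S U"
    using mem(1) proj_along_fixed_iff[OF c] by auto
qed

lemma proj_along_intertwines:
  assumes "complementary S U" "complementary S' U'" "linear T" "T ` S \<subseteq> S'" "T ` U \<subseteq> U'"
  shows "proj_along S' U' \<circ> T = T \<circ> proj_along S U"
proof
  fix v
  show "(proj_along S' U' \<circ> T) v = (T \<circ> proj_along S U) v"
    unfolding o_apply
  proof (rule proj_along_eqI[OF assms(2)])
    show "T (proj_along S U v) \<in> S'"
      using proj_along_mem(1)[OF assms(1)] assms(4) by auto
    show "T v - T (proj_along S U v) \<in> U'"
      using proj_along_mem(2)[OF assms(1), of v] assms(5)
      by (auto simp: linear_diff[OF assms(3), symmetric])
  qed
qed

text \<open>\<open>S'\<close> is the orthogonal complement of \<open>S \<inter> U\<close> within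
  \<open>S\<close>: the part of \<open>s\<close> in the intersection can be moved over to
  \<open>U\<close>. Getting \<open>S'\<close> inside \<open>S\<close>, rather than any complement of
  \<open>U\<close>, is what later makes the two projections at time 0 compatible.\<close>

lemma complementary_shrink_left:
  fixes S U :: "'a::euclidean_space set"
  assumes S: "subspace S" and U: "subspace U" and sum: "\<And>v. \<exists>s\<in>S. v - s \<in> U"
  obtains S' where "S' \<subseteq> S" "complementary S' U"
proof
  let ?W = "S \<inter> U"
  let ?S' = "{x \<in> S. \<forall>y \<in> ?W. orthogonal x y}"
  show "?S' \<subseteq> S"
    by blast
  have W: "subspace ?W"
    using S U by (rule subspace_inter)
  have "subspace ?S'"
    using S unfolding subspace_def by (auto simp: orthogonal_clauses)
  moreover have "?S' \<inter> U = {0}"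
  proof
    show "?S' \<inter> U \<subseteq> {0}"
      using orthogonal_self by blast
    show "{0} \<subseteq> ?S' \<inter> U"
      using S U by (auto simp: subspace_0 orthogonal_clauses)
  qed
  moreover have "\<exists>s\<in>?S'. v - s \<in> U" for v
  proof -
    obtain s where s: "s \<in> S" "v - s \<in> U"
      using sum by blast
    obtain y z where yz: "y \<in> span ?W" "\<And>w. w \<in> span ?W \<Longrightarrow> orthogonal z w" "s = y + z"
      using orthogonal_subspace_decomp_exists by metis
    have y: "y \<in> ?W"
      using yz(1) W by (simp add: span_eq_iff[THEN iffD2])
    have z: "z = s - y" "v - z = (v - s) + y"
      using yz(3) by simp_all
    have "z \<in> S"
      using z(1) y s S by (auto intro: subspace_diff)
    then have "z \<in> ?S'"
      using yz(2) by (auto intro: span_base)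
    moreover have "v - z \<in> U"
      unfolding z(2) using s y U by (intro subspace_add) auto
    ultimately show ?thesis
      by blast
  qed
  ultimately show "complementary ?S' U"
    using U unfolding complementary_def by blast
qed

lemma complementary_commute: "complementary S U \<longleftrightarrow> complementary U S"
proof -
  have "complementary U S" if "complementary S U" for S U :: "'a set"
  proof -
    have "\<exists>s\<in>U. v - s \<in> S" for v
      using proj_along_mem[OF that, of v] by (intro bexI[of _ "v - proj_along S U v"]) auto
    then show ?thesis
      using that unfolding complementary_def by blast
  qed
  then show ?thesis
    by blast
qed

section \<open>The Green function of an invariant splitting\<close>

lemma linear_cocycle_steps:
  assumes "\<And>n. linear (A n)"
  shows "linear (cocycle_steps A n k)"
  by (induction k) (auto simp only: cocycle_steps.simps intro: linear_id linear_compose assms)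

lemma cocycle_steps_add:
  "cocycle_steps A n (k + l) = cocycle_steps A (n + int k) l \<circ> cocycle_steps A n k"
  by (induction l) (simp_all add: fun_eq_iff algebra_simps)

lemma cocycle_steps_solution:
  assumes "\<And>i. n \<le> i \<Longrightarrow> i < n + int k \<Longrightarrow> x (i + 1) = A i (x i)"
  shows "cocycle_steps A n k (x n) = x (n + int k)"
  using assms
proof (induction k)
  case (Suc k)
  then have "cocycle_steps A n (Suc k) (x n) = A (n + int k) (x (n + int k))"
    by simp
  also have "\<dots> = x (n + int k + 1)"
    using Suc.prems[of "n + int k"] by simp
  finally show ?case
    by (simp add: algebra_simps)
qed simp

definition green :: "(int \<Rightarrow> 'a::real_vector \<Rightarrow> 'a) \<Rightarrow> (int \<Rightarrow> 'a \<Rightarrow> 'a) \<Rightarrow> int \<Rightarrow> int \<Rightarrow> 'a \<Rightarrow> 'a" where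
  "green A P m n v = (if n \<le> m then cocycle A P m n (P n v) else - cocycle A P m n (v - P n v))"

text \<open>The algebra of a dichotomy without its estimates, so that the identities of the Green
  function are available before decay is known, and on both half-lines at once. Time 0 is the base
  point at which bounded solutions are compared.\<close>

locale invariant_splitting =
  fixes A P :: "int \<Rightarrow> 'a::real_vector \<Rightarrow> 'a" and J :: "int set"
  assumes linear_A: "linear (A n)"
    and interval: "a \<in> J \<Longrightarrow> b \<in> J \<Longrightarrow> a \<le> c \<Longrightarrow> c \<le> b \<Longrightarrow> c \<in> J"
    and zero_in_J: "0 \<in> J"
    and projection_P: "n \<in> J \<Longrightarrow> projection (P n)"
    and P_A: "n \<in> J \<Longrightarrow> n + 1 \<in> J \<Longrightarrow> P (n + 1) \<circ> A n = A n \<circ> P n"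
    and bij_A: "n \<in> J \<Longrightarrow> n + 1 \<in> J \<Longrightarrow> bij_betw (A n) (Ker (P n)) (Ker (P (n + 1)))"
begin

lemma linear_P: "n \<in> J \<Longrightarrow> linear (P n)"
  using projection_P unfolding projection_def by blast

lemma P_P: "n \<in> J \<Longrightarrow> P n (P n v) = P n v"
  using projection_P unfolding projection_def by (auto simp: fun_eq_iff)

lemma linear_steps: "linear (cocycle_steps A n k)"
  by (rule linear_cocycle_steps) (rule linear_A)

lemma diff_P_in_Ker: "n \<in> J \<Longrightarrow> v - P n v \<in> Ker (P n)"
  by (simp add: Ker_def linear_diff[OF linear_P] P_P)

lemma steps_in_J:
  assumes "n \<in> J" "n + int (Suc k) \<in> J"
  shows "n + int k \<in> J" "n + int k + 1 \<in> J"
  using assms interval[of n "n + int (Suc k)"] by (auto simp: algebra_simps)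

lemma P_steps:
  assumes "n \<in> J" "n + int k \<in> J"
  shows "P (n + int k) (cocycle_steps A n k v) = cocycle_steps A n k (P n v)"
  using assms(2)
proof (induction k)
  case (Suc k)
  note J = steps_in_J[OF assms(1) Suc.prems]
  have eq: "n + int (Suc k) = n + int k + 1"
    by simp
  show ?case
    using Suc.IH[OF J(1)] P_A[OF J] unfolding eq by (simp add: fun_eq_iff)
qed simp

lemma bij_steps:
  assumes "n \<in> J" "n + int k \<in> J"
  shows "bij_betw (cocycle_steps A n k) (Ker (P n)) (Ker (P (n + int k)))"
  using assms(2)
proof (induction k)
  case 0
  then show ?case by (simp add: bij_betw_def)
next
  case (Suc k)
  note J = steps_in_J[OF assms(1) Suc.prems]
  have eq: "n + int (Suc k) = n + int k + 1"
    by simp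
  show ?case
    unfolding eq cocycle_steps.simps by (rule bij_betw_trans[OF Suc.IH[OF J(1)] bij_A[OF J]])
qed

lemma bij_steps_nat:
  assumes "m \<in> J" "n \<in> J" "m \<le> n"
  shows "bij_betw (cocycle_steps A m (nat (n - m))) (Ker (P m)) (Ker (P n))"
  using bij_steps[of m "nat (n - m)"] assms by simp

lemma cocycle_backward:
  assumes "m \<in> J" "n \<in> J" "m \<le> n" "u \<in> Ker (P n)"
  shows "cocycle A P m n u \<in> Ker (P m)" "cocycle_steps A m (nat (n - m)) (cocycle A P m n u) = u"
proof -
  note bij = bij_steps_nat[OF assms(1-3)]
  have "cocycle A P m n u \<in> Ker (P m) \<and> cocycle_steps A m (nat (n - m)) (cocycle A P m n u) = u"
  proof (cases "m = n")
    case True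
    then show ?thesis
      using assms by (simp add: cocycle_def)
  next
    case False
    then show ?thesis
      using assms bij_betw_inv_into_right[OF bij assms(4)] bij_betwE[OF bij_betw_inv_into[OF bij]]
      by (simp add: cocycle_def)
  qed
  then show "cocycle A P m n u \<in> Ker (P m)"
    "cocycle_steps A m (nat (n - m)) (cocycle A P m n u) = u"
    by auto
qed

lemma cocycle_backward_eqI:
  assumes "m \<in> J" "n \<in> J" "m \<le> n" "x \<in> Ker (P m)"
  shows "cocycle A P m n (cocycle_steps A m (nat (n - m)) x) = x"
proof (cases "m = n")
  case True
  then show ?thesis
    by (simp add: cocycle_def)
next
  case False
  then show ?thesis
    using assms bij_betw_inv_into_left[OF bij_steps_nat[OF assms(1-3)] assms(4)]
    by (simp add: cocycle_def)
qed

text \<open>\<open>inv_into\<close> carries no algebra of its own. Both sides of each identity are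
  preimages in \<open>Ker (P m)\<close> of the same vector, hence equal by injectivity
  there.\<close>

lemma linear_cocycle_diff:
  assumes "m \<in> J" "n \<in> J" "m \<le> n"
  shows "linear (\<lambda>v. cocycle A P m n (v - P n v))"
proof (rule linearI)
  fix x y :: 'a and r :: real
  let ?c = "cocycle A P m n" and ?s = "cocycle_steps A m (nat (n - m))"
  note bw = cocycle_backward[OF assms diff_P_in_Ker[OF assms(2)]]
  note lin = linear_steps[of m "nat (n - m)"] linear_P[OF assms(2)]
  note inv = cocycle_backward_eqI[OF assms]
  note Pm = linear_P[OF assms(1)]
  have "?s (?c (x - P n x) + ?c (y - P n y)) = x + y - P n (x + y)"
    by (simp add: linear_add[OF lin(1)] bw linear_add[OF lin(2)])
  moreover have "?c (x - P n x) + ?c (y - P n y) \<in> Ker (P m)"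
    using bw(1) by (simp add: Ker_def linear_add[OF Pm])
  ultimately show "?c (x + y - P n (x + y)) = ?c (x - P n x) + ?c (y - P n y)"
    using inv by metis
  have "?s (r *\<^sub>R ?c (x - P n x)) = r *\<^sub>R x - P n (r *\<^sub>R x)"
    by (simp add: linear_scale[OF lin(1)] bw linear_scale[OF lin(2)] algebra_simps)
  moreover have "r *\<^sub>R ?c (x - P n x) \<in> Ker (P m)"
    using bw(1) by (simp add: Ker_def linear_scale[OF Pm])
  ultimately show "?c (r *\<^sub>R x - P n (r *\<^sub>R x)) = r *\<^sub>R ?c (x - P n x)"
    using inv by metis
qed

abbreviation G :: "int \<Rightarrow> int \<Rightarrow> 'a \<Rightarrow> 'a" where
  "G \<equiv> green A P"

lemma G_forward: "n \<le> m \<Longrightarrow> G m n v = cocycle_steps A n (nat (m - n)) (P n v)"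
  by (simp add: green_def cocycle_def)

text \<open>Injectivity on \<open>Ker (P m)\<close> makes the last two premises determine the value,
  so later identities can be checked without unfolding \<open>inv_into\<close>.\<close>

lemma G_backward_eqI:
  assumes "m \<in> J" "n \<in> J" "m < n" "x \<in> Ker (P m)" "cocycle_steps A m (nat (n - m)) x = P n v - v"
  shows "G m n v = x"
proof -
  have "- x \<in> Ker (P m)" "cocycle_steps A m (nat (n - m)) (- x) = v - P n v"
    using assms by (auto simp: Ker_def linear_neg[OF linear_P] linear_neg[OF linear_steps])
  then have "cocycle A P m n (v - P n v) = - x"
    using cocycle_backward_eqI[of m n "- x"] assms(1-3) by simp
  then show ?thesis
    using assms(3) by (simp add: green_def)
qed

lemma G_backward:
  assumes "m \<in> J" "n \<in> J" "m < n"
  shows "P m (G m n v) = 0" "cocycle_steps A m (nat (n - m)) (G m n v) = P n v - v"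
proof -
  have "m \<le> n"
    using assms by simp
  note bw = cocycle_backward[OF assms(1,2) this diff_P_in_Ker[OF assms(2)]]
  show "P m (G m n v) = 0"
    using bw(1) assms by (simp add: green_def Ker_def linear_neg[OF linear_P])
  show "cocycle_steps A m (nat (n - m)) (G m n v) = P n v - v"
    using bw(2) assms by (simp add: green_def linear_neg[OF linear_steps])
qed

lemma P_G_forward:
  assumes "m \<in> J" "n \<in> J" "n \<le> m"
  shows "P m (G m n v) = G m n v"
  using P_steps[of n "nat (m - n)" "P n v"] assms by (simp add: G_forward P_P)

lemma linear_G:
  assumes "m \<in> J" "n \<in> J"
  shows "linear (G m n)"
proof (cases "n \<le> m")
  case True
  then show ?thesis
    using linear_compose[OF linear_P[OF assms(2)] linear_steps[of n "nat (m - n)"]]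
      G_forward[OF True] unfolding o_def by presburger
next
  case False
  then have "linear (\<lambda>v. - cocycle A P m n (v - P n v))"
    using linear_cocycle_diff[OF assms] by (intro linear_compose_neg) auto
  then show ?thesis
    using False by (simp add: green_def[abs_def])
qed

text \<open>The minus sign in \<open>green\<close> produces the jump
  \<open>P n v - (P n v - v) = v\<close> at \<open>m + 1 = n\<close>. Hence a Green sum solves the
  inhomogeneous equation in which the step from \<open>m\<close> to \<open>m + 1\<close> adds
  \<open>w (m + 1)\<close>.\<close>

lemma G_step:
  assumes "m \<in> J" "m + 1 \<in> J" "n \<in> J"
  shows "G (m + 1) n v = A m (G m n v) + (if m + 1 = n then v else 0)"
proof -
  consider "n \<le> m" | "n = m + 1" | "m + 1 < n"
    by linarith
  then show ?thesis
  proof cases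
    case 1
    then have "nat (m + 1 - n) = Suc (nat (m - n))"
      by simp
    then show ?thesis
      using 1 by (simp add: G_forward)
  next
    case 2
    then have "A m (G m n v) = P n v - v"
      using G_backward(2)[of m n v] assms by simp
    then show ?thesis
      using 2 by (simp add: G_forward)
  next
    case 3
    have "G (m + 1) n v = A m (G m n v)"
    proof (rule G_backward_eqI)
      show "A m (G m n v) \<in> Ker (P (m + 1))"
        using P_A[OF assms(1,2)] G_backward(1)[of m n v] assms 3
        by (simp add: Ker_def fun_eq_iff linear_0[OF linear_A])
      have "nat (n - m) = 1 + nat (n - (m + 1))"
        using 3 by simp
      then have "cocycle_steps A m (nat (n - m))
          = cocycle_steps A (m + 1) (nat (n - (m + 1))) \<circ> A m"
        by (simp only: cocycle_steps_add) simp
      then show "cocycle_steps A (m + 1) (nat (n - (m + 1))) (A m (G m n v)) = P n v - v"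
        using G_backward(2)[of m n v] assms 3 by simp
    qed (use assms 3 in auto)
    then show ?thesis
      using 3 by simp
  qed
qed

lemma G_G_forward:
  assumes "m \<in> J" "j \<in> J" "n \<in> J" "n \<le> j" "j \<le> m"
  shows "G m j (G j n v) = G m n v"
proof -
  have "nat (m - n) = nat (j - n) + nat (m - j)"
    using assms by simp
  then have "cocycle_steps A n (nat (m - n)) (P n v)
      = cocycle_steps A j (nat (m - j)) (cocycle_steps A n (nat (j - n)) (P n v))"
    using cocycle_steps_add[of A n "nat (j - n)" "nat (m - j)"] assms by simp
  also have "cocycle_steps A n (nat (j - n)) (P n v) = P j (G j n v)"
    using P_G_forward[of j n v] assms by (simp add: G_forward)
  finally show ?thesis
    using assms by (simp add: G_forward)
qed

text \<open>Two minus signs against one give the sign. The inequalities have to be strict: for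
  \<open>m < n\<close>, the composition with \<open>j = m\<close> or \<open>j = n\<close> vanishes,
  because one factor is then a projection that meets the kernel part of the other.\<close>

lemma G_G_backward:
  assumes "m \<in> J" "j \<in> J" "n \<in> J" "m < j" "j < n"
  shows "G m j (G j n v) = - G m n v"
proof -
  let ?x = "G m j (G j n v)"
  have x: "P m ?x = 0" "cocycle_steps A m (nat (j - m)) ?x = - G j n v"
    using G_backward[of m j] G_backward(1)[of j n v] assms by auto
  have "nat (n - m) = nat (j - m) + nat (n - j)"
    using assms by simp
  then have "cocycle_steps A m (nat (n - m)) ?x = v - P n v"
    using cocycle_steps_add[of A m "nat (j - m)" "nat (n - j)"] assms x
      G_backward(2)[of j n v] by (simp add: linear_neg[OF linear_steps])
  then have "G m n v = - ?x"
    using assms x by (intro G_backward_eqI)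
      (auto simp: Ker_def linear_neg[OF linear_P] linear_neg[OF linear_steps])
  then show ?thesis
    by simp
qed

end

section \<open>Admissibility and exponential dichotomies\<close>

definition admissible :: "('a::real_vector \<Rightarrow> real) \<Rightarrow> (int \<Rightarrow> 'a \<Rightarrow> 'a) \<Rightarrow> real \<Rightarrow> bool" where
  "admissible N A L \<longleftrightarrow>
     (\<forall>\<delta>>0. \<forall>w. (\<exists>K. \<forall>n<K. w n = 0) \<longrightarrow> (\<forall>n. N (w n) \<le> \<delta>) \<longrightarrow>
        (\<exists>z. \<forall>n. z (n + 1) = A n (z n) + w n \<and> N (z n) \<le> L * \<delta>))"

text \<open>Since \<open>A n\<close> need not be invertible, an arbitrary inhomogeneity \<open>w\<close> cannot be turned into a
  pseudo-orbit by backward recursion. Vanishing of \<open>w\<close> near \<open>-\<infinity>\<close> makes forward recursion possible.\<close>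

lemma hyers_ulam_stable_imp_admissible:
  assumes N: "is_norm N" and lin: "\<And>n. linear (A n)" and "hyers_ulam_stable N A"
  obtains L where "L > 0" "admissible N A L"
proof -
  obtain L where L: "L > 0" and stable:
    "\<And>\<delta> y. \<delta> > 0 \<Longrightarrow> (\<And>n. N (y (n + 1) - A n (y n)) \<le> \<delta>) \<Longrightarrow>
       \<exists>x. is_solution A x \<and> (\<forall>n. N (x n - y n) \<le> L * \<delta>)"
    using assms(3) unfolding hyers_ulam_stable_def by metis
  have "\<exists>z. \<forall>n. z (n + 1) = A n (z n) + w n \<and> N (z n) \<le> L * \<delta>"
    if \<delta>: "\<delta> > 0" and K: "\<And>n. n < K \<Longrightarrow> w n = 0" and w: "\<And>n. N (w n) \<le> \<delta>" for \<delta> w K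
  proof -
    \<comment> \<open>\<open>nat\<close> truncates at 0, so \<open>y\<close> vanishes up to time
      \<open>K\<close> and the recursion starts there.\<close>
    define y where
      "y n = rec_nat 0 (\<lambda>k x. A (K + int k) x + w (K + int k)) (nat (n - K))" for n
    have y: "y (n + 1) = A n (y n) + w n" for n
    proof (cases "n < K")
      case True
      then show ?thesis
        using K by (simp add: y_def linear_0[OF lin])
    next
      case False
      then have "nat (n + 1 - K) = Suc (nat (n - K))" "K + int (nat (n - K)) = n"
        by simp_all
      then show ?thesis
        by (simp add: y_def)
    qed
    then obtain x where x: "\<And>n. x (n + 1) = A n (x n)" "\<And>n. N (x n - y n) \<le> L * \<delta>"
      using stable[OF \<delta>, of y] w unfolding is_solution_def by auto
    \<comment> \<open>The pseudo-orbit \<open>y\<close> may be unbounded; subtracting the nearby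
      true solution leaves a bounded solution with the same inhomogeneity.\<close>
    have "N (y n - x n) \<le> L * \<delta>" for n
      using x(2)[of n] is_norm_minus[OF N, of "x n - y n"] by simp
    then show ?thesis
      using x(1) y by (intro exI[of _ "\<lambda>n. y n - x n"]) (simp add: linear_diff[OF lin])
  qed
  then show ?thesis
    using L that unfolding admissible_def by blast
qed

text \<open>Uniqueness of bounded solutions on \<open>J\<close> is encoded by the family \<open>h\<close>, which recovers a
  bounded homogeneous solution from its value at \<open>0\<close>. The Green sum then differs from the solution
  given by admissibility by a homogeneous solution that is controlled by its value at \<open>0\<close>.\<close>

lemma green_sum_bounded:
  fixes A P :: "int \<Rightarrow> 'a::euclidean_space \<Rightarrow> 'a" and h :: "int \<Rightarrow> 'a \<Rightarrow> 'a"
  assumes N: "is_norm N" and split: "invariant_splitting A P J"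
    and L: "L > 0" "admissible N A L"
    and green_bdd: "\<And>n v. n \<in> J \<Longrightarrow> \<exists>M. \<forall>m\<in>J. N (green A P m n v) \<le> M"
    and h_linear: "\<And>m. m \<in> J \<Longrightarrow> linear (h m)"
    and h_bdd: "\<And>v. \<exists>M. \<forall>m\<in>J. N (h m v) \<le> M"
    and h_unique: "\<And>x M m. (\<And>m. m \<in> J \<Longrightarrow> N (x m) \<le> M) \<Longrightarrow>
        (\<And>m. m \<in> J \<Longrightarrow> m + 1 \<in> J \<Longrightarrow> x (m + 1) = A m (x m)) \<Longrightarrow> m \<in> J \<Longrightarrow> x m = h m (x 0)"
    and h_green: "\<And>m j v. m \<in> J \<Longrightarrow> j \<in> J \<Longrightarrow> j \<noteq> 0 \<Longrightarrow> h m (green A P 0 j v) = 0"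
  obtains K where "K > 0"
    "\<And>F w \<delta> m. finite F \<Longrightarrow> F \<subseteq> J \<Longrightarrow> \<delta> > 0 \<Longrightarrow> (\<And>j. j \<in> F \<Longrightarrow> N (w j) \<le> \<delta>) \<Longrightarrow> m \<in> J \<Longrightarrow>
       N (\<Sum>j\<in>F. green A P m j (w j)) \<le> K * \<delta>"
proof -
  interpret invariant_splitting A P J
    by (rule split)
  obtain C where C: "C > 0" "\<And>m v. m \<in> J \<Longrightarrow> N (h m v) \<le> C * N v"
    using linear_family_bounded[OF N, of J h] h_linear h_bdd by blast
  obtain C0 where C0: "C0 > 0" "\<And>v. N (G 0 0 v) \<le> C0 * N v"
    using linear_family_bounded[OF N, of "{()}" "\<lambda>_. G 0 0"] linear_G[OF zero_in_J zero_in_J] by auto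
  \<comment> \<open>The three summands bound \<open>z m\<close>, \<open>h m (s 0)\<close> and
    \<open>h m (z 0)\<close> in the decomposition \<open>s_eq\<close> below.\<close>
  have bound: "N (\<Sum>j\<in>F. G m j (w j)) \<le> (L + C * C0 + C * L) * \<delta>"
    if F: "finite F" "F \<subseteq> J" and \<delta>: "\<delta> > 0" and w: "\<And>j. j \<in> F \<Longrightarrow> N (w j) \<le> \<delta>" and m: "m \<in> J"
    for F w \<delta> m
  proof -
    \<comment> \<open>The Green sum adds \<open>w (m + 1)\<close> in the step leaving time
      \<open>m\<close>, while \<open>admissible\<close> indexes an inhomogeneity by the time it
      leaves; hence the shift.\<close>
    define w' where "w' n = (if n + 1 \<in> F then w (n + 1) else 0)" for n
    \<comment> \<open>Inserting 0 keeps the minimum meaningful when \<open>F\<close> is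
      empty.\<close>
    have "\<forall>n<Min (insert 0 F) - 1. w' n = 0"
    proof (intro allI impI)
      fix n assume n: "n < Min (insert 0 F) - 1"
      have "n + 1 \<notin> F"
      proof
        assume "n + 1 \<in> F"
        then have "Min (insert 0 F) \<le> n + 1"
          using F(1) by (intro Min_le) auto
        then show False
          using n by linarith
      qed
      then show "w' n = 0"
        by (simp add: w'_def)
    qed
    moreover have "N (w' n) \<le> \<delta>" for n
      using w \<delta> by (simp add: w'_def is_norm_zero[OF N])
    ultimately obtain z where z: "\<And>n. z (n + 1) = A n (z n) + w' n" "\<And>n. N (z n) \<le> L * \<delta>"
      using L(2) \<delta> unfolding admissible_def by metis
    define s where "s m = (\<Sum>j\<in>F. G m j (w j))" for m
    have s_step: "s (m + 1) = A m (s m) + w' m" if "m \<in> J" "m + 1 \<in> J" for m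
    proof -
      have "s (m + 1) = (\<Sum>j\<in>F. A m (G m j (w j)) + (if m + 1 = j then w j else 0))"
        unfolding s_def using that F(2) by (intro sum.cong refl) (auto simp: G_step)
      then show ?thesis
        using F(1) by (simp add: s_def w'_def sum.distrib linear_sum[OF linear_A])
    qed
    have "\<forall>j\<in>F. \<exists>M. \<forall>m\<in>J. N (G m j (w j)) \<le> M"
      using green_bdd F(2) by blast
    then obtain M where M: "\<And>j m. j \<in> F \<Longrightarrow> m \<in> J \<Longrightarrow> N (G m j (w j)) \<le> M j"
      using bchoice[of F "\<lambda>j M. \<forall>m\<in>J. N (G m j (w j)) \<le> M"] by blast
    \<comment> \<open>This bound depends on \<open>F\<close> and \<open>w\<close>. It only qualifies
      \<open>s - z\<close> for the uniqueness property; the uniform bound comes afterwards from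
      \<open>s_eq\<close>.\<close>
    have s_bdd: "N (s m) \<le> (\<Sum>j\<in>F. M j)" if "m \<in> J" for m
      unfolding s_def using M that by (intro order_trans[OF is_norm_sum[OF N]] sum_mono) auto
    have "s m - z m = h m (s 0 - z 0)"
    proof (rule h_unique[of "\<lambda>m. s m - z m"])
      show "N (s m - z m) \<le> (\<Sum>j\<in>F. M j) + L * \<delta>" if "m \<in> J" for m
        using is_norm_diff[OF N, of "s m" "z m"] s_bdd[OF that] z(2)[of m] by linarith
      show "s (m + 1) - z (m + 1) = A m (s m - z m)" if "m \<in> J" "m + 1 \<in> J" for m
        using s_step[OF that] z(1)[of m] by (simp add: linear_diff[OF linear_A])
    qed (fact m)
    then have s_eq: "s m = z m + h m (s 0) - h m (z 0)"
      by (simp add: linear_diff[OF h_linear[OF m]] algebra_simps)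
    \<comment> \<open>By \<open>h_green\<close> only the term with \<open>j = 0\<close> survives, so
      this contribution does not grow with \<open>F\<close>.\<close>
    have "h m (s 0) = (\<Sum>j\<in>F. h m (G 0 j (w j)))"
      by (simp add: s_def linear_sum[OF h_linear[OF m]])
    also have "\<dots> = (\<Sum>j\<in>F. if 0 = j then h m (G 0 j (w j)) else 0)"
      using F(2) m by (intro sum.cong refl) (auto simp: h_green)
    also have "\<dots> = (if 0 \<in> F then h m (G 0 0 (w 0)) else 0)"
      using F(1) by simp
    finally have hs: "h m (s 0) = (if 0 \<in> F then h m (G 0 0 (w 0)) else 0)" .
    have "N (h m (s 0)) \<le> C * (C0 * \<delta>)"
    proof (cases "0 \<in> F")
      case True
      have "N (h m (s 0)) \<le> C * N (G 0 0 (w 0))"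
        using hs True C(2)[OF m] by simp
      also have "\<dots> \<le> C * (C0 * N (w 0))"
        using C(1) C0(2) by (intro mult_left_mono) auto
      also have "\<dots> \<le> C * (C0 * \<delta>)"
        using C(1) C0(1) w[OF True] by (intro mult_left_mono) auto
      finally show ?thesis .
    next
      case False
      then show ?thesis
        using hs C(1) C0(1) \<delta> by (simp add: is_norm_zero[OF N])
    qed
    moreover have "N (h m (z 0)) \<le> C * (L * \<delta>)"
      using C(1) z(2)[of 0] by (intro order_trans[OF C(2)[OF m]] mult_left_mono) auto
    moreover have "N (s m) \<le> N (z m) + N (h m (s 0)) + N (h m (z 0))"
      unfolding s_eq using is_norm_diff[OF N, of "z m + h m (s 0)" "h m (z 0)"]
        is_normD(4)[OF N, of "z m" "h m (s 0)"] by linarith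
    ultimately have "N (s m) \<le> L * \<delta> + C * (C0 * \<delta>) + C * (L * \<delta>)"
      using z(2)[of m] by linarith
    then show ?thesis
      by (simp add: s_def algebra_simps)
  qed
  have "L + C * C0 + C * L > 0"
    using L(1) C(1) C0(1) by (simp add: add_pos_pos)
  then show ?thesis
    using bound by (rule that)
qed

text \<open>\<open>B k c\<close> stands for: every propagator over a time span \<open>k\<close> has norm at most \<open>c\<close>.\<close>

lemma submultiplicative_exp_decay:
  fixes B :: "nat \<Rightarrow> real \<Rightarrow> bool"
  assumes K: "K \<ge> 1" "\<And>k. B k K"
    and mono: "\<And>k c c'. B k c \<Longrightarrow> c \<le> c' \<Longrightarrow> B k c'"
    and mult: "\<And>k l c c'. B k c \<Longrightarrow> B l c' \<Longrightarrow> 0 < k \<Longrightarrow> 0 < l \<Longrightarrow> 0 \<le> c \<Longrightarrow> B (k + l) (c * c')"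
    and decay: "\<And>k. k > 0 \<Longrightarrow> B (Suc k) (K * K / real k)"
  obtains D \<mu> where "D > 0" "\<mu> > 0" "\<And>k. B k (D * exp (- \<mu> * real k))"
proof -
  \<comment> \<open>Large enough for the bound \<open>K * K / k0\<close> of \<open>decay\<close> to
    drop below \<open>exp (- 1)\<close>.\<close>
  obtain k0 :: nat where k0: "real k0 > K * K * exp 1"
    using reals_Archimedean2 by blast
  have pos: "real k0 > 0"
    using k0 K(1) by (intro less_trans[OF _ k0]) simp
  let ?T = "Suc k0"
  have "K * K / real k0 \<le> exp (- 1)"
    using k0 pos by (simp add: exp_minus field_simps)
  then have T: "B ?T (exp (- 1))"
    using decay[of k0] pos mono by auto
  have steps: "B (q * ?T + r) (K * exp (- real q))" for q r
  proof (induction q)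
    case 0
    then show ?case
      using K(2) by simp
  next
    case (Suc q)
    show ?case
    proof (cases "q * ?T + r = 0")
      \<comment> \<open>Here the remaining span is 0, where \<open>mult\<close> does not apply; the
        bound for one full span \<open>?T\<close> is used directly.\<close>
      case True
      have "exp (- 1) \<le> K * exp (- 1)"
        using K(1) by simp
      then show ?thesis
        using True mono[OF T] by simp
    next
      case False
      then have B: "B (?T + (q * ?T + r)) (exp (- 1) * (K * exp (- real q)))"
        by (intro mult[OF T Suc.IH]) auto
      have eq1: "exp (- 1) * (K * exp (- real q)) = K * exp (- real (Suc q))"
        by (simp add: exp_add[symmetric] algebra_simps exp_diff exp_minus divide_simps)
      have eq2: "?T + (q * ?T + r) = Suc q * ?T + r"
        by simp
      show ?thesis
        using B unfolding eq1 eq2 .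
    qed
  qed
  \<comment> \<open>Each full span \<open>?T\<close> gains \<open>exp (- 1)\<close>, so the rate is
    \<open>1 / ?T\<close>; discarding the incomplete last span costs at most the factor
    \<open>exp 1\<close>.\<close>
  have "B k (K * exp 1 * exp (- (1 / ?T) * real k))" for k
  proof -
    let ?q = "k div ?T"
    have "k < (?q + 1) * ?T"
      using dividend_less_times_div[of ?T k] by (simp only: algebra_simps) simp
    then have "real k \<le> real ((?q + 1) * ?T)"
      by linarith
    then have "real k / ?T \<le> real ?q + 1"
      by (simp add: field_simps)
    then have "exp (- real ?q) \<le> exp (1 + - (1 / ?T) * real k)"
      by simp
    then have "K * exp (- real ?q) \<le> K * exp 1 * exp (- (1 / ?T) * real k)"
      using K(1) unfolding exp_add by simp
    moreover have "B k (K * exp (- real ?q))"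
      using steps[of ?q "k mod ?T"] by (metis div_mult_mod_eq)
    ultimately show ?thesis
      using mono by blast
  qed
  then show ?thesis
    using K(1) by (intro that[of "K * exp 1" "1 / ?T"]) auto
qed

text \<open>Applying the bound to \<open>w j = G(j, n) v\<close> gives \<open>\<Sum>\<^sub>j G(m, j) G(j, n) v\<close>, which is
  \<open>G(m, n) v\<close> times (up to sign) the number of terms; this forces decay in \<open>\<bar>m - n\<bar>\<close>.\<close>

lemma exp_dichotomy_if_green_sum_bounded:
  fixes A P :: "int \<Rightarrow> 'a::euclidean_space \<Rightarrow> 'a"
  assumes N: "is_norm N" and split: "invariant_splitting A P J"
    and "K > 0"
    and sum_le: "\<And>F w \<delta> m. finite F \<Longrightarrow> F \<subseteq> J \<Longrightarrow> \<delta> > 0 \<Longrightarrow> (\<And>j. j \<in> F \<Longrightarrow> N (w j) \<le> \<delta>) \<Longrightarrow>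
       m \<in> J \<Longrightarrow> N (\<Sum>j\<in>F. green A P m j (w j)) \<le> K * \<delta>"
  shows "exp_dichotomy N A J P"
proof -
  interpret invariant_splitting A P J
    by (rule split)
  \<comment> \<open>\<open>submultiplicative_exp_decay\<close> wants a constant of at least
    1.\<close>
  define K' where "K' = max 1 K"
  have K': "K' \<ge> 1"
    by (simp add: K'_def)
  have sum_le': "N (\<Sum>j\<in>F. G m j (w j)) \<le> K' * \<delta>"
    if "finite F" "F \<subseteq> J" "\<delta> > 0" "\<And>j. j \<in> F \<Longrightarrow> N (w j) \<le> \<delta>" "m \<in> J" for F w \<delta> m
  proof -
    have "K * \<delta> \<le> K' * \<delta>"
      using that(3) by (simp add: K'_def)
    then show ?thesis
      using sum_le[OF that(1-3), of w m] that(4,5) by fastforce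
  qed
  have G_0: "N (G m n v) = 0" if "m \<in> J" "n \<in> J" "N v = 0" for m n v
    using that by (simp add: is_normD(2)[OF N] linear_0[OF linear_G])
  have G_le: "N (G m n v) \<le> K' * N v" if "m \<in> J" "n \<in> J" for m n v
  proof (cases "N v = 0")
    case True
    then show ?thesis
      using G_0[OF that] by simp
  next
    case False
    then have "N v > 0"
      using is_normD(1)[OF N, of v] by linarith
    then show ?thesis
      using sum_le'[of "{n}" "N v" "\<lambda>_. v" m] that by simp
  qed
  \<comment> \<open>One factor \<open>K'\<close> bounds the inhomogeneity \<open>G j n v\<close>,
    the other the Green sum. The summands are all equal, so nothing cancels and their number appears
    on the left.\<close>
  have G_sum: "real (card F) * N (G m n v) \<le> K' * K' * N v"
    if mn: "m \<in> J" "n \<in> J" and F: "finite F" "F \<subseteq> J"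
      and comp: "\<And>j. j \<in> F \<Longrightarrow> G m j (G j n v) = c *\<^sub>R G m n v" and c: "\<bar>c\<bar> = 1" for m n v F c
  proof (cases "N v = 0")
    case True
    then show ?thesis
      using G_0[OF mn] by simp
  next
    case False
    then have "K' * N v > 0"
      using is_normD(1)[OF N, of v] K' by simp
    then have "N (\<Sum>j\<in>F. G m j (G j n v)) \<le> K' * (K' * N v)"
      using F mn by (intro sum_le') (auto intro!: G_le)
    moreover have "(\<Sum>j\<in>F. G m j (G j n v)) = (real (card F) * c) *\<^sub>R G m n v"
      using comp by (simp add: sum_constant_scaleR)
    ultimately show ?thesis
      using c by (simp add: is_normD(3)[OF N] abs_mult)
  qed
  \<comment> \<open>Forward and backward propagators are treated separately, since they compose with
    different signs and orders.\<close>
  define Bf where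
    "Bf k c \<longleftrightarrow> (\<forall>n v. n \<in> J \<longrightarrow> n + int k \<in> J \<longrightarrow> N (G (n + int k) n v) \<le> c * N v)" for k c
  define Bb where
    "Bb k c \<longleftrightarrow> (\<forall>n v. n \<in> J \<longrightarrow> n + int k \<in> J \<longrightarrow> N (G n (n + int k) v) \<le> c * N v)" for k c
  obtain D1 \<mu>1 where 1: "D1 > 0" "\<mu>1 > 0" "\<And>k. Bf k (D1 * exp (- \<mu>1 * real k))"
  proof (rule submultiplicative_exp_decay[of K' Bf])
    show "Bf k K'" for k
      unfolding Bf_def using G_le by blast
    show "Bf k c'" if "Bf k c" "c \<le> c'" for k c c'
      using that unfolding Bf_def by (meson is_normD(1)[OF N] mult_right_mono order_trans)
    show "Bf (k + l) (c * c')" if "Bf k c" "Bf l c'" "0 < k" "0 < l" "0 \<le> c" for k l c c'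
      unfolding Bf_def
    proof (intro allI impI)
      fix n v assume n: "n \<in> J" "n + int (k + l) \<in> J"
      then have J: "n + int l \<in> J" "n + int l + int k \<in> J"
        using interval[of n "n + int (k + l)" "n + int l"] by (auto simp: algebra_simps)
      have "N (G (n + int l + int k) (n + int l) (G (n + int l) n v)) \<le> c * N (G (n + int l) n v)"
        using that(1) J unfolding Bf_def by blast
      also have "\<dots> \<le> c * (c' * N v)"
        using that(2,5) J n unfolding Bf_def by (intro mult_left_mono) auto
      finally show "N (G (n + int (k + l)) n v) \<le> c * c' * N v"
        using G_G_forward[of "n + int l + int k" "n + int l" n v] J n by (simp add: algebra_simps)
    qed
    show "Bf (Suc k) (K' * K' / real k)" if "k > 0" for k
      unfolding Bf_def
    proof (intro allI impI)
      fix n v assume n: "n \<in> J" "n + int (Suc k) \<in> J"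
      \<comment> \<open>A span of \<open>k + 1\<close> has \<open>k\<close> interior times. Only
        these are summed, in parallel with the backward case, where the composition identity fails
        at the endpoints.\<close>
      have "real (card {n + 1..n + int k}) * N (G (n + int (Suc k)) n v) \<le> K' * K' * N v"
      proof (rule G_sum[of _ _ _ _ 1])
        show J: "{n + 1..n + int k} \<subseteq> J"
          using n interval[of n "n + int (Suc k)"] by auto
        show "G (n + int (Suc k)) j (G j n v) = 1 *\<^sub>R G (n + int (Suc k)) n v"
          if "j \<in> {n + 1..n + int k}" for j
          using that J n by (simp add: G_G_forward subset_iff)
      qed (use n in auto)
      then show "N (G (n + int (Suc k)) n v) \<le> K' * K' / real k * N v"
        using that by (simp add: field_simps)
    qed
  qed (use K' in auto)
  obtain D2 \<mu>2 where 2: "D2 > 0" "\<mu>2 > 0" "\<And>k. Bb k (D2 * exp (- \<mu>2 * real k))"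
  proof (rule submultiplicative_exp_decay[of K' Bb])
    show "Bb k K'" for k
      unfolding Bb_def using G_le by blast
    show "Bb k c'" if "Bb k c" "c \<le> c'" for k c c'
      using that unfolding Bb_def by (meson is_normD(1)[OF N] mult_right_mono order_trans)
    show "Bb (k + l) (c * c')" if "Bb k c" "Bb l c'" "0 < k" "0 < l" "0 \<le> c" for k l c c'
      unfolding Bb_def
    proof (intro allI impI)
      fix n v assume n: "n \<in> J" "n + int (k + l) \<in> J"
      then have J: "n + int k \<in> J" "n + int k + int l \<in> J"
        using interval[of n "n + int (k + l)" "n + int k"] by (auto simp: algebra_simps)
      let ?g = "G (n + int k) (n + int k + int l) v"
      have "N (G n (n + int k) ?g) \<le> c * N ?g"
        using that(1) J n unfolding Bb_def by blast
      also have "\<dots> \<le> c * (c' * N v)"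
        using that(2,5) J n unfolding Bb_def by (intro mult_left_mono) auto
      finally show "N (G n (n + int (k + l)) v) \<le> c * c' * N v"
        using G_G_backward[of n "n + int k" "n + int k + int l" v] J n that
        by (simp add: algebra_simps is_norm_minus[OF N])
    qed
    show "Bb (Suc k) (K' * K' / real k)" if "k > 0" for k
      unfolding Bb_def
    proof (intro allI impI)
      fix n v assume n: "n \<in> J" "n + int (Suc k) \<in> J"
      have "real (card {n + 1..n + int k}) * N (G n (n + int (Suc k)) v) \<le> K' * K' * N v"
      proof (rule G_sum[of _ _ _ _ "- 1"])
        show J: "{n + 1..n + int k} \<subseteq> J"
          using n interval[of n "n + int (Suc k)"] by auto
        show "G n j (G j (n + int (Suc k)) v) = - 1 *\<^sub>R G n (n + int (Suc k)) v"
          if "j \<in> {n + 1..n + int k}" for j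
          using that J n by (simp add: G_G_backward subset_iff)
      qed (use n in auto)
      then show "N (G n (n + int (Suc k)) v) \<le> K' * K' / real k * N v"
        using that by (simp add: field_simps)
    qed
  qed (use K' in auto)
  \<comment> \<open>The part \<open>1 + K'\<close> covers the diagonal of the second estimate, where
    the operator is the identity minus \<open>P n\<close> whereas \<open>G n n\<close> is
    \<open>P n\<close>.\<close>
  define D where "D = D1 + D2 + 1 + K'"
  define \<mu> where "\<mu> = min \<mu>1 \<mu>2"
  have D: "D > 0"
    using 1(1) 2(1) K' by (simp add: D_def)
  have weaken: "D' * exp (- \<mu>' * t) \<le> D * exp (- \<mu> * t)"
    if "0 < D'" "D' \<le> D" "\<mu> \<le> \<mu>'" "0 \<le> t" for D' \<mu>' t
    using that by (intro mult_mono) (auto intro: mult_right_mono)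
  have fwd: "op_norm N (cocycle A P m n \<circ> P n) \<le> D * exp (- \<mu> * real_of_int (m - n))"
    if mn: "m \<in> J" "n \<in> J" "n \<le> m" for m n
  proof (rule op_norm_le[OF N])
    fix v
    let ?t = "real (nat (m - n))"
    have "N (G m n v) \<le> (D1 * exp (- \<mu>1 * ?t)) * N v"
      using 1(3)[of "nat (m - n)", unfolded Bf_def, rule_format, of n v] mn by simp
    also have "\<dots> \<le> (D * exp (- \<mu> * ?t)) * N v"
      using 1 2 K' by (intro mult_right_mono weaken is_normD(1)[OF N]) (auto simp: D_def \<mu>_def)
    finally show "N ((cocycle A P m n \<circ> P n) v) \<le> D * exp (- \<mu> * real_of_int (m - n)) * N v"
      using mn by (simp add: green_def)
  qed (use D in auto)
  have bwd: "op_norm N (cocycle A P m n \<circ> (\<lambda>x. x - P n x)) \<le> D * exp (- \<mu> * real_of_int (n - m))"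
    if mn: "m \<in> J" "n \<in> J" "m \<le> n" for m n
  proof (rule op_norm_le[OF N])
    fix v
    show "N ((cocycle A P m n \<circ> (\<lambda>x. x - P n x)) v) \<le> D * exp (- \<mu> * real_of_int (n - m)) * N v"
    proof (cases "m = n")
      case True
      have "N (v - P n v) \<le> N v + K' * N v"
        using is_norm_diff[OF N, of v "P n v"] G_le[of n n v] mn by (simp add: G_forward)
      also have "\<dots> \<le> D * N v"
        using 1(1) 2(1) is_normD(1)[OF N, of v] by (simp add: D_def algebra_simps)
      finally show ?thesis
        using True by (simp add: cocycle_def)
    next
      case False
      let ?t = "real (nat (n - m))"
      have "N (G m n v) \<le> (D2 * exp (- \<mu>2 * ?t)) * N v"
        using 2(3)[of "nat (n - m)", unfolded Bb_def, rule_format, of m v] mn by simp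
      also have "\<dots> \<le> (D * exp (- \<mu> * ?t)) * N v"
        using 1 2 K' by (intro mult_right_mono weaken is_normD(1)[OF N]) (auto simp: D_def \<mu>_def)
      finally show ?thesis
        using mn False by (simp add: green_def is_norm_minus[OF N])
    qed
  qed (use D in auto)
  have \<mu>: "\<mu> > 0"
    using 1 2 by (simp add: \<mu>_def)
  show ?thesis
    unfolding exp_dichotomy_def
    by (intro conjI exI[of _ D] exI[of _ \<mu>] ballI allI impI; (elim conjE)?;
        (rule D \<mu> projection_P P_A bij_A fwd bwd; assumption))
qed

section \<open>Forward and backward bounded orbits\<close>

definition forward_bounded :: "('a::real_vector \<Rightarrow> real) \<Rightarrow> (int \<Rightarrow> 'a \<Rightarrow> 'a) \<Rightarrow> int \<Rightarrow> 'a set" where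
  "forward_bounded N A n = {v. \<exists>M. \<forall>k. N (cocycle_steps A n k v) \<le> M}"

text \<open>As the \<open>A k\<close> need not be invertible, membership asks for the existence of
  some bounded backward orbit ending in \<open>v\<close>; nothing here makes it unique.\<close>

definition backward_bounded :: "('a::real_vector \<Rightarrow> real) \<Rightarrow> (int \<Rightarrow> 'a \<Rightarrow> 'a) \<Rightarrow> int \<Rightarrow> 'a set" where
  "backward_bounded N A n =
     {v. \<exists>x M. x n = v \<and> (\<forall>k\<le>n. N (x k) \<le> M) \<and> (\<forall>k<n. x (k + 1) = A k (x k))}"

lemma cocycle_steps_Suc_right: "cocycle_steps A n (Suc k) = cocycle_steps A (n + 1) k \<circ> A n"
  using cocycle_steps_add[of A n 1 k] by simp

lemma forward_boundedI:
  assumes "\<And>k. n \<le> k \<Longrightarrow> N (x k) \<le> M" "\<And>k. n \<le> k \<Longrightarrow> x (k + 1) = A k (x k)"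
  shows "x n \<in> forward_bounded N A n"
  using cocycle_steps_solution[of n _ x A] assms
  unfolding forward_bounded_def by (auto intro!: exI[of _ M])

text \<open>One step more or less does not affect boundedness of a forward orbit. The converse
  direction makes \<open>forward_bounded N A n\<close> a full preimage, which therefore contains the
  kernel of a linear \<open>A n\<close>.\<close>

lemma A_in_forward_bounded_iff: "A n v \<in> forward_bounded N A (n + 1) \<longleftrightarrow> v \<in> forward_bounded N A n"
proof
  assume "A n v \<in> forward_bounded N A (n + 1)"
  then obtain M where M: "\<And>k. N (cocycle_steps A n (Suc k) v) \<le> M"
    unfolding forward_bounded_def cocycle_steps_Suc_right by auto
  have "N (cocycle_steps A n k v) \<le> max M (N v)" for k
    using M[of "k - 1"] by (cases k) (auto simp: le_max_iff_disj)
  then show "v \<in> forward_bounded N A n"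
    unfolding forward_bounded_def by blast
next
  assume "v \<in> forward_bounded N A n"
  then obtain M where "\<And>k. N (cocycle_steps A n k v) \<le> M"
    unfolding forward_bounded_def by auto
  then have "N (cocycle_steps A (n + 1) k (A n v)) \<le> M" for k
    using cocycle_steps_Suc_right[of A n k] by (metis o_apply)
  then show "A n v \<in> forward_bounded N A (n + 1)"
    unfolding forward_bounded_def by blast
qed

lemma steps_in_forward_bounded_iff:
  "cocycle_steps A n k v \<in> forward_bounded N A (n + int k) \<longleftrightarrow> v \<in> forward_bounded N A n"
proof (induction k)
  case (Suc k)
  have "n + int (Suc k) = n + int k + 1"
    by simp
  then show ?case
    using Suc A_in_forward_bounded_iff[of A "n + int k" "cocycle_steps A n k v" N]
    by (simp only: cocycle_steps.simps o_apply)
qed simp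

lemma subspace_forward_bounded:
  assumes N: "is_norm N" and lin: "\<And>n. linear (A n)"
  shows "subspace (forward_bounded N A n)"
proof (rule subspaceI)
  note steps = linear_cocycle_steps[of A n, OF lin]
  show "0 \<in> forward_bounded N A n"
    using linear_0[OF steps] is_norm_zero[OF N] by (auto simp: forward_bounded_def)
  fix u v and c :: real
  assume "u \<in> forward_bounded N A n"
  then obtain M where M: "\<And>k. N (cocycle_steps A n k u) \<le> M"
    unfolding forward_bounded_def by blast
  have "N (cocycle_steps A n k (c *\<^sub>R u)) \<le> \<bar>c\<bar> * M" for k
    using M by (simp add: linear_scale[OF steps] is_normD(3)[OF N] mult_left_mono)
  then show "c *\<^sub>R u \<in> forward_bounded N A n"
    unfolding forward_bounded_def by blast
  assume "v \<in> forward_bounded N A n"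
  then obtain M' where M': "\<And>k. N (cocycle_steps A n k v) \<le> M'"
    unfolding forward_bounded_def by blast
  have "N (cocycle_steps A n k (u + v)) \<le> M + M'" for k
    unfolding linear_add[OF steps]
    using is_normD(4)[OF N] add_mono[OF M M'] by (rule order_trans)
  then show "u + v \<in> forward_bounded N A n"
    unfolding forward_bounded_def by blast
qed

lemma backward_boundedE:
  assumes "v \<in> backward_bounded N A n"
  obtains x M where "x n = v" "\<And>k. k \<le> n \<Longrightarrow> N (x k) \<le> M" "\<And>k. k < n \<Longrightarrow> x (k + 1) = A k (x k)"
    "\<And>k. k \<le> n \<Longrightarrow> x k \<in> backward_bounded N A k"
    "\<And>k. k \<le> n \<Longrightarrow> cocycle_steps A k (nat (n - k)) (x k) = v"
proof -
  obtain x M where x: "x n = v" "\<And>k. k \<le> n \<Longrightarrow> N (x k) \<le> M" "\<And>k. k < n \<Longrightarrow> x (k + 1) = A k (x k)"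
    using assms unfolding backward_bounded_def by blast
  have "x k \<in> backward_bounded N A k" if "k \<le> n" for k
    unfolding backward_bounded_def using x that by (auto intro!: exI[of _ x] exI[of _ M])
  moreover have "cocycle_steps A k (nat (n - k)) (x k) = v" if "k \<le> n" for k
    using cocycle_steps_solution[of k "nat (n - k)" x A] x that by simp
  ultimately show ?thesis
    using that x by blast
qed

lemma backward_boundedI:
  assumes "\<And>k. k \<le> n \<Longrightarrow> N (x k) \<le> M" "\<And>k. k < n \<Longrightarrow> x (k + 1) = A k (x k)"
  shows "x n \<in> backward_bounded N A n"
  using assms unfolding backward_bounded_def by blast

lemma A_in_backward_bounded:
  assumes "v \<in> backward_bounded N A n"
  shows "A n v \<in> backward_bounded N A (n + 1)"
proof -
  obtain x M where x: "x n = v" "\<And>k. k \<le> n \<Longrightarrow> N (x k) \<le> M" "\<And>k. k < n \<Longrightarrow> x (k + 1) = A k (x k)"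
    using backward_boundedE[OF assms] by metis
  define y where "y = x(n + 1 := A n v)"
  have "y (n + 1) \<in> backward_bounded N A (n + 1)"
  proof (rule backward_boundedI)
    show "N (y k) \<le> max M (N (A n v))" if "k \<le> n + 1" for k
      using x(2)[of k] that by (auto simp: y_def le_max_iff_disj)
    show "y (k + 1) = A k (y k)" if "k < n + 1" for k
      using x(1) x(3)[of k] that by (cases "k = n") (auto simp: y_def)
  qed
  then show ?thesis
    by (simp add: y_def)
qed

lemma steps_in_backward_bounded:
  assumes "v \<in> backward_bounded N A n"
  shows "cocycle_steps A n k v \<in> backward_bounded N A (n + int k)"
proof (induction k)
  case (Suc k)
  have "n + int (Suc k) = n + int k + 1"
    by simp
  then show ?case
    using A_in_backward_bounded[OF Suc.IH] by (simp only: cocycle_steps.simps o_apply)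
qed (simp add: assms)

lemma subspace_backward_bounded:
  assumes N: "is_norm N" and lin: "\<And>n. linear (A n)"
  shows "subspace (backward_bounded N A n)"
proof (rule subspaceI)
  show "0 \<in> backward_bounded N A n"
    using backward_boundedI[of n N "\<lambda>_. 0" 0 A] by (simp add: linear_0[OF lin] is_norm_zero[OF N])
  fix u v and c :: real
  assume "u \<in> backward_bounded N A n"
  then obtain x M where x: "x n = u" "\<And>k. k \<le> n \<Longrightarrow> N (x k) \<le> M"
    "\<And>k. k < n \<Longrightarrow> x (k + 1) = A k (x k)"
    by (metis backward_boundedE)
  have "(\<lambda>k. c *\<^sub>R x k) n \<in> backward_bounded N A n"
    using x by (intro backward_boundedI[where M = "\<bar>c\<bar> * M"])
      (auto simp: linear_scale[OF lin] is_normD(3)[OF N] mult_left_mono)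
  then show "c *\<^sub>R u \<in> backward_bounded N A n"
    by (simp add: x(1))
  assume "v \<in> backward_bounded N A n"
  then obtain y M' where y: "y n = v" "\<And>k. k \<le> n \<Longrightarrow> N (y k) \<le> M'"
    "\<And>k. k < n \<Longrightarrow> y (k + 1) = A k (y k)"
    by (metis backward_boundedE)
  have "(\<lambda>k. x k + y k) n \<in> backward_bounded N A n"
  proof (rule backward_boundedI[where M = "M + M'"])
    show "N (x k + y k) \<le> M + M'" if "k \<le> n" for k
      using is_normD(4)[OF N, of "x k" "y k"] x(2)[OF that] y(2)[OF that] by linarith
  qed (use x y in \<open>simp add: linear_add[OF lin]\<close>)
  then show "u + v \<in> backward_bounded N A n"
    by (simp add: x(1) y(1))
qed

section \<open>Dichotomies on the two half-lines from admissibility\<close>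

text \<open>The error \<open>v\<close> enters in the step from \<open>n - 1\<close> to
  \<open>n\<close>. The bounded response \<open>z\<close> is a homogeneous orbit from
  \<open>n\<close> on and up to \<open>n - 1\<close>, and \<open>v - z n\<close> is minus the image
  of its backward part. The bound \<open>N v + 1\<close> keeps \<delta> positive when
  \<open>v = 0\<close>.\<close>

lemma admissible_forward_backward_sum:
  assumes N: "is_norm N" and lin: "\<And>n. linear (A n)" and L: "admissible N A L"
  shows "\<exists>s\<in>forward_bounded N A n. v - s \<in> backward_bounded N A n"
proof -
  define w where "w k = (if k = n - 1 then v else 0)" for k
  have \<delta>: "N v + 1 > 0" and "\<And>k. N (w k) \<le> N v + 1" "\<forall>k<n - 1. w k = 0"
    using is_normD(1)[OF N, of v] by (auto simp: w_def is_norm_zero[OF N])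
  then obtain z where z: "\<And>k. z (k + 1) = A k (z k) + w k" "\<And>k. N (z k) \<le> L * (N v + 1)"
    using L unfolding admissible_def by metis
  have s: "z n \<in> forward_bounded N A n"
    using z by (intro forward_boundedI) (auto simp: w_def)
  have "z (n - 1) \<in> backward_bounded N A (n - 1)"
    using z by (intro backward_boundedI) (auto simp: w_def)
  then have "A (n - 1) (z (n - 1)) \<in> backward_bounded N A n"
    using A_in_backward_bounded[of _ N A "n - 1"] by simp
  then have "- A (n - 1) (z (n - 1)) \<in> backward_bounded N A n"
    by (intro subspace_neg subspace_backward_bounded[OF N] lin)
  moreover have "v - z n = - A (n - 1) (z (n - 1))"
    using z(1)[of "n - 1"] by (simp add: w_def)
  ultimately show ?thesis
    using s by (intro bexI[of _ "z n"]) simp_all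
qed

lemma bounded_off_finite:
  assumes N: "is_norm N" and F: "finite F" and M: "\<And>m. m \<in> J - F \<Longrightarrow> N (f m) \<le> M"
  shows "\<exists>M. \<forall>m\<in>J. N (f m) \<le> M"
proof (intro exI ballI)
  fix m assume m: "m \<in> J"
  have nn: "0 \<le> (\<Sum>i\<in>F. N (f i))"
    by (intro sum_nonneg is_normD(1)[OF N])
  show "N (f m) \<le> max M 0 + (\<Sum>i\<in>F. N (f i))"
  proof (cases "m \<in> F")
    case True
    then show ?thesis
      using member_le_sum[OF True is_normD(1)[OF N] F, of f] by linarith
  next
    case False
    then show ?thesis
      using M[of m] m nn by auto
  qed
qed

lemma exp_dichotomy_nonneg:
  fixes A :: "int \<Rightarrow> 'a::euclidean_space \<Rightarrow> 'a"
  assumes N: "is_norm N" and lin: "\<And>n. linear (A n)" and L: "L > 0" "admissible N A L"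
    and compl: "complementary (forward_bounded N A 0) V"
  obtains P where "P 0 = proj_along (forward_bounded N A 0) V" "exp_dichotomy N A {0..} P"
proof -
  define S where "S = forward_bounded N A"
  define U where "U n = cocycle_steps A 0 (nat n) ` V" for n
  define P where "P n = proj_along (S n) (U n)" for n
  have V: "subspace V" "S 0 \<inter> V = {0}" "\<And>v. \<exists>s\<in>S 0. v - s \<in> V"
    using compl unfolding complementary_def S_def by auto
  have steps: "linear (cocycle_steps A n k)" for n k
    by (rule linear_cocycle_steps) (rule lin)
  have sub: "subspace (S n)" for n
    unfolding S_def by (rule subspace_forward_bounded[of N A, OF N lin])
  have S_steps: "cocycle_steps A 0 (nat n) v \<in> S n \<longleftrightarrow> v \<in> S 0" if "n \<ge> 0" for n v
    using steps_in_forward_bounded_iff[of A 0 "nat n" v N] that by (simp add: S_def)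
  have cmp: "complementary (S n) (U n)" if n: "n \<ge> 0" for n
    unfolding complementary_def
  proof (intro conjI allI)
    show "subspace (S n)" "subspace (U n)"
      unfolding U_def using sub linear_subspace_image[OF steps V(1)] by auto
    have "v = 0" if "v \<in> S n" "v \<in> U n" for v
    proof -
      obtain u where u: "u \<in> V" "v = cocycle_steps A 0 (nat n) u"
        using \<open>v \<in> U n\<close> unfolding U_def by blast
      then have "u \<in> S 0 \<inter> V"
        using \<open>v \<in> S n\<close> S_steps[OF n] by blast
      then show "v = 0"
        using V(2) u linear_0[OF steps] by simp
    qed
    then show "S n \<inter> U n = {0}"
      using subspace_0[OF \<open>subspace (S n)\<close>] subspace_0[OF \<open>subspace (U n)\<close>] by blast
    fix v
    obtain s where s: "s \<in> S n" "v - s \<in> backward_bounded N A n"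
      using admissible_forward_backward_sum[of N A L n v, OF N lin L(2)] unfolding S_def by blast
    \<comment> \<open>A backward orbit ending in \<open>v - s\<close> passes through time 0.
      Splitting its value there along \<open>S 0\<close> and \<open>V\<close>, and transporting
      forward, yields the decomposition at time \<open>n\<close>.\<close>
    obtain y where y: "cocycle_steps A 0 (nat n) y = v - s"
      using backward_boundedE[OF s(2)] n by (metis diff_zero)
    obtain s0 where s0: "s0 \<in> S 0" "y - s0 \<in> V"
      using V(3) by blast
    show "\<exists>s\<in>S n. v - s \<in> U n"
    proof
      show "s + cocycle_steps A 0 (nat n) s0 \<in> S n"
        using s(1) s0(1) S_steps[OF n] sub by (blast intro: subspace_add)
      have "v - (s + cocycle_steps A 0 (nat n) s0) = cocycle_steps A 0 (nat n) (y - s0)"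
        using y by (simp add: linear_diff[OF steps])
      then show "v - (s + cocycle_steps A 0 (nat n) s0) \<in> U n"
        using s0(2) by (simp add: U_def)
    qed
  qed
  have A_steps: "A n (cocycle_steps A 0 (nat n) v) = cocycle_steps A 0 (nat (n + 1)) v"
    if "n \<ge> 0" for n v
    using that by (simp add: nat_add_distrib)
  have A_U: "A n ` U n = U (n + 1)" if "n \<ge> 0" for n
    using A_steps[OF that] unfolding U_def image_image by simp
  have A_S: "A n v \<in> S (n + 1) \<longleftrightarrow> v \<in> S n" for n v
    unfolding S_def by (rule A_in_forward_bounded_iff)
  \<comment> \<open>The kernel of \<open>A n\<close> lies in \<open>S n\<close>, which meets
    \<open>U n\<close> only in 0.\<close>
  have inj: "inj_on (A n) (U n)" if n: "n \<ge> 0" for n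
  proof (rule inj_onI)
    fix u u' assume u: "u \<in> U n" "u' \<in> U n" "A n u = A n u'"
    then have "u - u' \<in> U n"
      using cmp[OF n] by (auto simp: complementary_def intro: subspace_diff)
    moreover have "u - u' \<in> S n"
      using u(3) subspace_0[OF sub, of "n + 1"] A_S[of n "u - u'"] by (simp add: linear_diff[OF lin])
    moreover have "S n \<inter> U n = {0}"
      using cmp[OF n] by (simp add: complementary_def)
    ultimately show "u = u'"
      by (metis IntI eq_iff_diff_eq_0 singletonD)
  qed
  have split: "invariant_splitting A P {0..}"
  proof
    show "projection (P n)" if "n \<in> {0..}" for n
      unfolding P_def using cmp that by (intro projection_proj_along) auto
    fix n :: int assume n: "n \<in> {0..}" "n + 1 \<in> {0..}"
    then show "P (n + 1) \<circ> A n = A n \<circ> P n"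
      unfolding P_def using cmp A_U A_S lin by (intro proj_along_intertwines) auto
    show "bij_betw (A n) (Ker (P n)) (Ker (P (n + 1)))"
      unfolding P_def using n cmp inj A_U by (simp add: Ker_proj_along bij_betw_def)
  qed (auto simp: linear_add[OF lin] linear_scale[OF lin])
  interpret invariant_splitting A P "{0..}"
    by (rule split)
  have G_bdd: "\<exists>M. \<forall>m\<in>{0..}. N (G m n v) \<le> M" if n: "n \<in> {0..}" for n v
  proof -
    have "P n v \<in> S n"
      unfolding P_def using cmp n by (intro proj_along_mem) auto
    then obtain M where "\<And>k. N (cocycle_steps A n k (P n v)) \<le> M"
      unfolding S_def forward_bounded_def by blast
    then have "N (G m n v) \<le> M" if "m \<in> {0..} - {0..<n}" for m
      using that by (auto simp: G_forward)
    then show ?thesis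
      by (intro bounded_off_finite[OF N, of "{0..<n}"]) auto
  qed
  obtain K where "K > 0"
    "\<And>F w \<delta> m. finite F \<Longrightarrow> F \<subseteq> {0..} \<Longrightarrow> \<delta> > 0 \<Longrightarrow> (\<And>j. j \<in> F \<Longrightarrow> N (w j) \<le> \<delta>) \<Longrightarrow> m \<in> {0..} \<Longrightarrow>
       N (\<Sum>j\<in>F. G m j (w j)) \<le> K * \<delta>"
  \<comment> \<open>A bounded forward orbit starts in \<open>S 0\<close>, where \<open>P 0\<close>
    is the identity, so \<open>G m 0\<close> reproduces it. For \<open>j > 0\<close> the values of
    \<open>G 0 j\<close> lie in \<open>Ker (P 0)\<close>, which \<open>G m 0\<close>
    annihilates.\<close>
  proof (rule green_sum_bounded[OF N split L, of "\<lambda>m. G m 0"])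
    show "linear (G m 0)" if "m \<in> {0..}" for m
      using that by (intro linear_G) auto
    show "\<exists>M. \<forall>m\<in>{0..}. N (G m n v) \<le> M" if "n \<in> {0..}" for n v
      using G_bdd[OF that] .
    show "\<exists>M. \<forall>m\<in>{0..}. N (G m 0 v) \<le> M" for v
      using G_bdd[of 0] by simp
    show "x m = G m 0 (x 0)"
      if x: "\<And>m. m \<in> {0..} \<Longrightarrow> N (x m) \<le> M" "m \<in> {0..}"
        "\<And>m. m \<in> {0..} \<Longrightarrow> m + 1 \<in> {0..} \<Longrightarrow> x (m + 1) = A m (x m)" for x M m
    proof -
      have "x 0 \<in> S 0"
        unfolding S_def using x by (intro forward_boundedI) auto
      then have "P 0 (x 0) = x 0"
        unfolding P_def using proj_along_fixed_iff[OF cmp[of 0]] by simp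
      then show ?thesis
        using x cocycle_steps_solution[of 0 "nat m" x A] by (simp add: G_forward)
    qed
    show "G m 0 (G 0 j v) = 0" if "m \<in> {0..}" "j \<in> {0..}" "j \<noteq> 0" for m j v
      using that G_backward(1)[of 0 j v] linear_0[OF steps] by (simp add: G_forward)
  qed (use that in blast)
  then have "exp_dichotomy N A {0..} P"
    by (rule exp_dichotomy_if_green_sum_bounded[OF N split])
  moreover have "P 0 = proj_along (forward_bounded N A 0) V"
    by (simp add: P_def S_def U_def)
  ultimately show ?thesis
    using that by blast
qed

lemma exp_dichotomy_nonpos:
  fixes A :: "int \<Rightarrow> 'a::euclidean_space \<Rightarrow> 'a"
  assumes N: "is_norm N" and lin: "\<And>n. linear (A n)" and L: "L > 0" "admissible N A L"
    and unique: "\<And>x :: int \<Rightarrow> 'a. \<lbrakk>\<exists>M. \<forall>n\<le>0. N (x n) \<le> M; x 0 = 0; \<forall>n\<le>-1. x (n + 1) = A n (x n)\<rbrakk>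
           \<Longrightarrow> \<forall>n\<le>0. x n = 0"
    and compl: "complementary V (backward_bounded N A 0)"
  obtains P where "P 0 = proj_along V (backward_bounded N A 0)" "exp_dichotomy N A {..0} P"
proof -
  define U where "U = backward_bounded N A"
  \<comment> \<open>A full preimage of \<open>V\<close>, since there need be no inverse along which
    \<open>V\<close> could be transported backward.\<close>
  define S where "S n = {v. cocycle_steps A n (nat (- n)) v \<in> V}" for n
  define P where "P n = proj_along (S n) (U n)" for n
  have V: "subspace V" "V \<inter> U 0 = {0}" "\<And>v. \<exists>s\<in>V. v - s \<in> U 0"
    using compl unfolding complementary_def U_def by auto
  have steps: "linear (cocycle_steps A n k)" for n k
    by (rule linear_cocycle_steps) (rule lin)
  have sub: "subspace (U n)" for n
    unfolding U_def by (rule subspace_backward_bounded[of N A, OF N lin])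
  \<comment> \<open>The only place where the uniqueness hypothesis acts: a bounded backward orbit
    ending in \<open>u\<close>, continued forward to time 0, is a bounded sequence with value 0
    there. The continuation adds finitely many terms and so keeps it bounded.\<close>
  have U_zero: "u = 0" if n: "n \<le> 0" and u: "u \<in> U n" "cocycle_steps A n (nat (- n)) u = 0" for n u
  proof -
    obtain x M where x: "x n = u" "\<And>k. k \<le> n \<Longrightarrow> N (x k) \<le> M" "\<And>k. k < n \<Longrightarrow> x (k + 1) = A k (x k)"
      using u(1) unfolding U_def by (metis backward_boundedE)
    define y where "y k = (if k \<le> n then x k else cocycle_steps A n (nat (k - n)) u)" for k
    have y_step: "y (k + 1) = A k (y k)" for k
    proof -
      consider "k < n" | "k = n" | "k > n"
        by linarith
      then show ?thesis
      proof cases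
        case 3
        then have "nat (k + 1 - n) = Suc (nat (k - n))" "n + int (nat (k - n)) = k"
          by auto
        then show ?thesis
          using 3 by (simp add: y_def)
      qed (use x in \<open>auto simp: y_def\<close>)
    qed
    have "\<exists>M. \<forall>m\<in>{..0}. N (y m) \<le> M"
      using x(2) by (intro bounded_off_finite[OF N, of "{n<..0}" _ _ M]) (auto simp: y_def)
    moreover have "y 0 = 0"
      using u(2) x(1) n by (cases "n = 0") (auto simp: y_def)
    ultimately have "\<forall>k\<le>0. y k = 0"
      using y_step by (intro unique) auto
    then show "u = 0"
      using n x(1) by (auto simp: y_def)
  qed
  have steps_U: "cocycle_steps A n (nat (- n)) u \<in> U 0" if "n \<le> 0" "u \<in> U n" for n u
    using steps_in_backward_bounded[of u N A n "nat (- n)"] that by (simp add: U_def)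
  have cmp: "complementary (S n) (U n)" if n: "n \<le> 0" for n
    unfolding complementary_def
  proof (intro conjI allI)
    show "subspace (S n)"
      unfolding S_def using V(1) by (rule linear_subspace_linear_preimage[OF steps])
    show "subspace (U n)"
      by (rule sub)
    have "v = 0" if "v \<in> S n" "v \<in> U n" for v
    proof -
      have "cocycle_steps A n (nat (- n)) v \<in> V \<inter> U 0"
        using that steps_U[OF n] by (simp add: S_def)
      then show "v = 0"
        using V(2) U_zero[OF n that(2)] by simp
    qed
    then show "S n \<inter> U n = {0}"
      using subspace_0[OF \<open>subspace (S n)\<close>] subspace_0[OF \<open>subspace (U n)\<close>] by blast
    fix v
    obtain s where s: "s \<in> V" "cocycle_steps A n (nat (- n)) v - s \<in> U 0"
      using V(3) by blast
    \<comment> \<open>The component in \<open>U 0\<close> of the image of \<open>v\<close> has a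
      bounded backward orbit; subtracting its value at time \<open>n\<close> from \<open>v\<close>
      leaves a vector that is mapped into \<open>V\<close>.\<close>
    obtain u where u: "u \<in> U n" "cocycle_steps A n (nat (- n)) u = cocycle_steps A n (nat (- n)) v - s"
      using backward_boundedE[OF s(2)[unfolded U_def]] n unfolding U_def by (metis diff_0)
    show "\<exists>s\<in>S n. v - s \<in> U n"
    proof
      show "v - u \<in> S n" "v - (v - u) \<in> U n"
        using u s(1) by (auto simp: S_def linear_diff[OF steps])
    qed
  qed
  have A_steps: "cocycle_steps A (n + 1) (nat (- (n + 1))) (A n v) = cocycle_steps A n (nat (- n)) v"
    if "n + 1 \<le> 0" for n v
  proof -
    have "nat (- n) = Suc (nat (- (n + 1)))"
      using that by auto
    then show ?thesis
      by (simp only: cocycle_steps_Suc_right o_apply)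
  qed
  have A_S: "A n ` S n \<subseteq> S (n + 1)" if "n + 1 \<le> 0" for n
    using A_steps[OF that] by (auto simp: S_def)
  have A_U: "A n ` U n = U (n + 1)" for n
  proof
    show "A n ` U n \<subseteq> U (n + 1)"
      unfolding U_def using A_in_backward_bounded by blast
    show "U (n + 1) \<subseteq> A n ` U n"
    proof
      fix u assume u: "u \<in> U (n + 1)"
      obtain x where "x (n + 1) = u" "x (n + 1) = A n (x n)" "x n \<in> U n"
        by (rule backward_boundedE[OF u[unfolded U_def]]) (auto simp: U_def)
      then show "u \<in> A n ` U n"
        by auto
    qed
  qed
  have inj: "inj_on (A n) (U n)" if n: "n + 1 \<le> 0" for n
  proof (rule inj_onI)
    fix u u' assume u: "u \<in> U n" "u' \<in> U n" "A n u = A n u'"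
    have "cocycle_steps A n (nat (- n)) (u - u') = 0"
      using A_steps[OF n, of "u - u'"] u(3) by (simp add: linear_diff[OF lin] linear_0[OF steps])
    moreover have "u - u' \<in> U n"
      using u sub by (blast intro: subspace_diff)
    ultimately show "u = u'"
      using U_zero[of n "u - u'"] n by simp
  qed
  have Ker_P: "Ker (P n) = U n" if "n \<le> 0" for n
    unfolding P_def by (rule Ker_proj_along[OF cmp[OF that]])
  have split: "invariant_splitting A P {..0}"
  proof
    show "projection (P n)" if "n \<in> {..0}" for n
      unfolding P_def using cmp that by (intro projection_proj_along) auto
    fix n :: int assume n: "n \<in> {..0}" "n + 1 \<in> {..0}"
    then show "P (n + 1) \<circ> A n = A n \<circ> P n"
      unfolding P_def using cmp A_U A_S lin by (intro proj_along_intertwines) auto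
    show "bij_betw (A n) (Ker (P n)) (Ker (P (n + 1)))"
      using n inj A_U by (simp add: Ker_P bij_betw_def)
  qed (auto simp: linear_add[OF lin] linear_scale[OF lin])
  interpret invariant_splitting A P "{..0}"
    by (rule split)
  have cocycle_bdd: "\<exists>M. \<forall>m\<le>n. N (cocycle A P m n u) \<le> M" if n: "n \<le> 0" and u: "u \<in> U n" for n u
  proof -
    obtain x M where x: "\<And>k. k \<le> n \<Longrightarrow> N (x k) \<le> M" "\<And>k. k \<le> n \<Longrightarrow> x k \<in> U k"
      "\<And>k. k \<le> n \<Longrightarrow> cocycle_steps A k (nat (n - k)) (x k) = u"
      by (rule backward_boundedE[OF u[unfolded U_def]]) (auto simp: U_def)
    have "cocycle A P m n u = x m" if "m \<le> n" for m
      using cocycle_backward_eqI[of m n "x m"] x(2,3)[OF that] n that by (simp add: Ker_P)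
    then show ?thesis
      using x(1) by auto
  qed
  have diff_P: "v - P n v \<in> U n" if "n \<le> 0" for n v
    using diff_P_in_Ker[of n v] that by (simp add: Ker_P)
  obtain K where "K > 0"
    "\<And>F w \<delta> m. finite F \<Longrightarrow> F \<subseteq> {..0} \<Longrightarrow> \<delta> > 0 \<Longrightarrow> (\<And>j. j \<in> F \<Longrightarrow> N (w j) \<le> \<delta>) \<Longrightarrow> m \<in> {..0} \<Longrightarrow>
       N (\<Sum>j\<in>F. G m j (w j)) \<le> K * \<delta>"
  \<comment> \<open>For \<open>m < 0\<close> this is \<open>- G m 0\<close>, but at
    \<open>m = 0\<close> it is the identity minus \<open>P 0\<close>, while \<open>G 0 0\<close> is
    \<open>P 0\<close>. Bounded backward orbits end in \<open>U 0 = Ker (P 0)\<close> and are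
    reproduced; for \<open>j \<le> 0\<close> the values of \<open>G 0 j\<close> lie in the range of
    \<open>P 0\<close> and are annihilated.\<close>
  proof (rule green_sum_bounded[OF N split L, of "\<lambda>m v. cocycle A P m 0 (v - P 0 v)"])
    show "linear (\<lambda>v. cocycle A P m 0 (v - P 0 v))" if "m \<in> {..0}" for m
      using that by (intro linear_cocycle_diff) auto
    show "\<exists>M. \<forall>m\<in>{..0}. N (G m n v) \<le> M" if n: "n \<in> {..0}" for n v
    proof -
      obtain M where "\<And>m. m \<le> n \<Longrightarrow> N (cocycle A P m n (v - P n v)) \<le> M"
        using cocycle_bdd[of n "v - P n v"] diff_P[of n v] n by auto
      then have "N (G m n v) \<le> M" if "m \<in> {..0} - {n..0}" for m
        using that by (auto simp: green_def is_norm_minus[OF N])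
      then show ?thesis
        by (intro bounded_off_finite[OF N, of "{n..0}"]) auto
    qed
    show "\<exists>M. \<forall>m\<in>{..0}. N (cocycle A P m 0 (v - P 0 v)) \<le> M" for v
      using cocycle_bdd[of 0 "v - P 0 v"] diff_P[of 0 v] by auto
    show "x m = cocycle A P m 0 (x 0 - P 0 (x 0))"
      if x: "\<And>m. m \<in> {..0} \<Longrightarrow> N (x m) \<le> M" "m \<in> {..0}"
        "\<And>m. m \<in> {..0} \<Longrightarrow> m + 1 \<in> {..0} \<Longrightarrow> x (m + 1) = A m (x m)" for x M m
    proof -
      have U: "x n \<in> Ker (P n)" if "n \<le> 0" for n
        using that x backward_boundedI[of n N x M A] by (simp add: Ker_P U_def)
      have "cocycle_steps A m (nat (0 - m)) (x m) = x 0"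
        using cocycle_steps_solution[of m "nat (- m)" x A] x by simp
      then show ?thesis
        using cocycle_backward_eqI[of m 0 "x m"] U[of m] U[of 0] x(2) by (simp add: Ker_def)
    qed
    show "cocycle A P m 0 (G 0 j v - P 0 (G 0 j v)) = 0" if "m \<in> {..0}" "j \<in> {..0}" for m j v
      using that P_G_forward[of 0 j v] linear_0[OF linear_cocycle_diff[of m 0]] linear_0[OF linear_P[of 0]]
      by simp
  qed (use that in blast)
  then have "exp_dichotomy N A {..0} P"
    by (rule exp_dichotomy_if_green_sum_bounded[OF N split])
  moreover have "P 0 = proj_along V (backward_bounded N A 0)"
    by (simp add: P_def S_def U_def)
  ultimately show ?thesis
    using that by blast
qed

lemma hyers_ulam_stable_imp_exp_trichotomy:
  fixes A :: "int \<Rightarrow> 'a::euclidean_space \<Rightarrow> 'a"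
  assumes N: "is_norm N" and lin: "\<And>n. linear (A n)"
    and unique: "\<And>x :: int \<Rightarrow> 'a. \<lbrakk>\<exists>M. \<forall>n\<le>0. N (x n) \<le> M; x 0 = 0; \<forall>n\<le>-1. x (n + 1) = A n (x n)\<rbrakk>
           \<Longrightarrow> \<forall>n\<le>0. x n = 0"
    and stable: "hyers_ulam_stable N A"
  shows "exp_trichotomy N A"
proof -
  obtain L where L: "L > 0" "admissible N A L"
    using hyers_ulam_stable_imp_admissible[of N A, OF N lin stable] .
  let ?S = "forward_bounded N A 0" and ?U = "backward_bounded N A 0"
  have S: "subspace ?S" and U: "subspace ?U"
    using subspace_forward_bounded[of N A, OF N lin] subspace_backward_bounded[of N A, OF N lin] by auto
  have sum: "\<exists>s\<in>?S. v - s \<in> ?U" for v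
    using admissible_forward_backward_sum[of N A, OF N lin L(2)] .
  have sum': "\<exists>u\<in>?U. v - u \<in> ?S" for v
  proof -
    obtain s where "s \<in> ?S" "v - s \<in> ?U"
      using sum by blast
    then show ?thesis
      by (intro bexI[of _ "v - s"]) auto
  qed
  obtain S' where S': "S' \<subseteq> ?S" "complementary S' ?U"
    using complementary_shrink_left[OF S U sum] .
  obtain U' where U': "U' \<subseteq> ?U" "complementary ?S U'"
    using complementary_shrink_left[OF U S sum'] complementary_commute by metis
  obtain Pp where Pp: "Pp 0 = proj_along ?S U'" "exp_dichotomy N A {0..} Pp"
    using exp_dichotomy_nonneg[of N A, OF N lin L U'(2)] .
  obtain Pm where Pm: "Pm 0 = proj_along S' ?U" "exp_dichotomy N A {..0} Pm"
    using exp_dichotomy_nonpos[of N A, OF N lin L unique S'(2)] .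
  have linm: "linear (Pm 0)"
    using projection_proj_along[OF S'(2)] unfolding Pm(1) projection_def by blast
  \<comment> \<open>The vectors \<open>v - Pp 0 v\<close> lie in \<open>U'\<close>, hence in
    \<open>?U\<close>, the kernel of \<open>Pm 0\<close>.\<close>
  have 1: "Pm 0 (Pp 0 v) = Pm 0 v" for v
  proof -
    have "v - Pp 0 v \<in> Ker (Pm 0)"
      using proj_along_mem(2)[OF U'(2), of v] U'(1) unfolding Pp(1) Pm(1) Ker_proj_along[OF S'(2)]
      by blast
    then show ?thesis
      by (simp add: Ker_def linear_diff[OF linm])
  qed
  have 2: "Pp 0 (Pm 0 v) = Pm 0 v" for v
    using proj_along_mem(1)[OF S'(2), of v] S'(1) unfolding Pp(1) Pm(1)
    by (intro iffD2[OF proj_along_fixed_iff[OF U'(2)]]) blast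
  show ?thesis
    unfolding exp_trichotomy_def using Pp(2) Pm(2) 1 2
    by (intro exI[of _ Pp] exI[of _ Pm]) (auto simp: fun_eq_iff)
qed

section \<open>From trichotomy to stability\<close>

text \<open>Equivalence of norms turns the bound on finite sums into absolute summability;
  closedness of balls of \<open>N\<close> carries the bound over to the limit.\<close>

lemma has_sum_is_norm_bounded:
  fixes f :: "'i \<Rightarrow> 'a::euclidean_space"
  assumes N: "is_norm N"
    and bound: "\<And>F. finite F \<Longrightarrow> F \<subseteq> I \<Longrightarrow> (\<Sum>j\<in>F. N (f j)) \<le> C"
  obtains s where "(f has_sum s) I" "N s \<le> C"
proof -
  obtain c where c: "c > 0" "\<And>x. norm x \<le> c * N x"
    using norm_le_is_norm[OF N] by blast
  have "(\<Sum>j\<in>F. norm (f j)) \<le> c * C" if F: "finite F" "F \<subseteq> I" for F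
  proof -
    have "(\<Sum>j\<in>F. norm (f j)) \<le> c * (\<Sum>j\<in>F. N (f j))"
      using c(2) by (simp add: sum_distrib_left sum_mono)
    then show ?thesis
      using mult_left_mono[OF bound[OF F], of c] c(1) by linarith
  qed
  then have "(\<lambda>j. norm (f j)) summable_on I"
    by (intro nonneg_bdd_above_summable_on) (auto simp: bdd_above_def)
  then have "f summable_on I"
    by (rule abs_summable_summable)
  then obtain s where s: "(f has_sum s) I"
    unfolding summable_on_def by blast
  have "s \<in> {v. N v \<le> C}"
  proof (rule Lim_in_closed_set)
    show "closed {v. N v \<le> C}"
      by (intro closed_Collect_le continuous_on_is_norm[OF N] continuous_on_const)
    show "\<forall>\<^sub>F F in finite_subsets_at_top I. sum f F \<in> {v. N v \<le> C}"
      using is_norm_sum[OF N, of f] bound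
      by (intro eventually_finite_subsets_at_top_weakI) (auto intro: order_trans)
    show "(sum f \<longlongrightarrow> s) (finite_subsets_at_top I)"
      using s by (simp add: has_sum_def)
  qed simp
  then show ?thesis
    using that s by simp
qed

text \<open>Two geometric series, one for each side of \<open>m\<close>; on either side the distance
  to \<open>m\<close> is injective.\<close>

lemma sum_exp_distance_le:
  fixes \<mu> :: real and m :: int
  assumes \<mu>: "\<mu> > 0" and F: "finite F"
  shows "(\<Sum>j\<in>F. exp (- \<mu> * real_of_int \<bar>m - j\<bar>)) \<le> 2 / (1 - exp (- \<mu>))"
proof -
  let ?r = "exp (- \<mu>)"
  have half: "(\<Sum>j\<in>F'. exp (- \<mu> * real_of_int \<bar>m - j\<bar>)) \<le> 1 / (1 - ?r)"
    if F': "finite F'" "inj_on (\<lambda>j. nat \<bar>m - j\<bar>) F'" for F'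
  proof -
    have "(\<Sum>j\<in>F'. exp (- \<mu> * real_of_int \<bar>m - j\<bar>)) = (\<Sum>j\<in>F'. ?r ^ nat \<bar>m - j\<bar>)"
      by (intro sum.cong refl) (simp add: exp_of_nat_mult[symmetric] mult.commute)
    also have "\<dots> = (\<Sum>k\<in>(\<lambda>j. nat \<bar>m - j\<bar>) ` F'. ?r ^ k)"
      using F'(2) by (simp add: sum.reindex)
    also have "\<dots> \<le> (\<Sum>k. ?r ^ k)"
      using F'(1) \<mu> by (intro sum_le_suminf summable_geometric) auto
    also have "\<dots> = 1 / (1 - ?r)"
      using \<mu> by (intro suminf_geometric) auto
    finally show ?thesis .
  qed
  have "F = {j \<in> F. j \<le> m} \<union> {j \<in> F. m < j}"
    by auto
  then have "(\<Sum>j\<in>F. exp (- \<mu> * real_of_int \<bar>m - j\<bar>))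
      = (\<Sum>j\<in>{j \<in> F. j \<le> m}. exp (- \<mu> * real_of_int \<bar>m - j\<bar>))
      + (\<Sum>j\<in>{j \<in> F. m < j}. exp (- \<mu> * real_of_int \<bar>m - j\<bar>))"
    using F by (metis (no_types, lifting) sum.union_disjoint finite_Un disjoint_iff mem_Collect_eq not_le)
  also have "\<dots> \<le> 1 / (1 - ?r) + 1 / (1 - ?r)"
    using F by (intro add_mono half) (auto simp: inj_on_def)
  finally show ?thesis
    by simp
qed

text \<open>Passing from \<open>op_norm\<close> to single vectors by \<open>le_op_norm\<close>
  requires linear maps; in the backward direction this is the linearity of the restricted
  inverse.\<close>

lemma exp_dichotomy_green_decay:
  fixes A P :: "int \<Rightarrow> 'a::euclidean_space \<Rightarrow> 'a"
  assumes N: "is_norm N" and lin: "\<And>n. linear (A n)"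
    and J: "0 \<in> J" "\<forall>a\<in>J. \<forall>b\<in>J. {a..b} \<subseteq> J"
    and dich: "exp_dichotomy N A J P"
  obtains D \<mu> where "invariant_splitting A P J" "D > 0" "\<mu> > 0"
    "\<And>m n v. m \<in> J \<Longrightarrow> n \<in> J \<Longrightarrow>
       N (green A P m n v) \<le> D * exp (- \<mu> * real_of_int \<bar>m - n\<bar>) * N v"
proof -
  have proj: "\<And>n. n \<in> J \<Longrightarrow> projection (P n)"
    using dich unfolding exp_dichotomy_def by blast
  from dich[unfolded exp_dichotomy_def, THEN conjunct2] obtain D \<mu> where D: "D > 0" "\<mu> > 0"
    and inv: "\<forall>n. n \<in> J \<and> n + 1 \<in> J \<longrightarrow>
           P (n + 1) \<circ> A n = A n \<circ> P n \<and> bij_betw (A n) (Ker (P n)) (Ker (P (n + 1)))"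
    and fwd: "\<forall>m\<in>J. \<forall>n\<in>J. n \<le> m \<longrightarrow>
           op_norm N (cocycle A P m n \<circ> P n) \<le> D * exp (- \<mu> * real_of_int (m - n))"
    and bwd: "\<forall>m\<in>J. \<forall>n\<in>J. m \<le> n \<longrightarrow>
           op_norm N (cocycle A P m n \<circ> (\<lambda>x. x - P n x)) \<le> D * exp (- \<mu> * real_of_int (n - m))"
    by (elim exE conjE) (rule that; assumption)
  have split: "invariant_splitting A P J"
  proof
    show "c \<in> J" if "a \<in> J" "b \<in> J" "a \<le> c" "c \<le> b" for a b c
      using J(2) that by (meson atLeastAtMost_iff subsetD)
    fix n assume n: "n \<in> J" "n + 1 \<in> J"
    show "P (n + 1) \<circ> A n = A n \<circ> P n" "bij_betw (A n) (Ker (P n)) (Ker (P (n + 1)))"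
      using inv[rule_format, of n] n by blast+
  qed (simp_all add: J(1) proj linear_add[OF lin] linear_scale[OF lin])
  interpret invariant_splitting A P J
    by (rule split)
  have "N (G m n v) \<le> D * exp (- \<mu> * real_of_int \<bar>m - n\<bar>) * N v" if mn: "m \<in> J" "n \<in> J" for m n v
  proof (cases "n \<le> m")
    case True
    have "linear (cocycle A P m n \<circ> P n)"
      using True linear_compose[OF linear_P[OF mn(2)] linear_steps] by (simp add: cocycle_def)
    then have "N (G m n v) \<le> op_norm N (cocycle A P m n \<circ> P n) * N v"
      using le_op_norm[OF N, of "cocycle A P m n \<circ> P n" v] True by (simp add: green_def)
    also have "\<dots> \<le> D * exp (- \<mu> * real_of_int (m - n)) * N v"
      using fwd[rule_format, OF mn True] is_normD(1)[OF N] by (rule mult_right_mono)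
    finally show ?thesis
      using True by simp
  next
    case False
    then have le: "m \<le> n"
      by simp
    have "linear (cocycle A P m n \<circ> (\<lambda>x. x - P n x))"
      using linear_cocycle_diff[OF mn le] by (simp add: o_def)
    then have "N (G m n v) \<le> op_norm N (cocycle A P m n \<circ> (\<lambda>x. x - P n x)) * N v"
      using le_op_norm[OF N, of "cocycle A P m n \<circ> (\<lambda>x. x - P n x)" v] False
      by (simp add: green_def is_norm_minus[OF N])
    also have "\<dots> \<le> D * exp (- \<mu> * real_of_int (n - m)) * N v"
      using bwd[rule_format, OF mn le] is_normD(1)[OF N] by (rule mult_right_mono)
    finally show ?thesis
      using False by simp
  qed
  then show ?thesis
    using that[OF split D] by blast
qed

section \<open>Bounded solutions on the half-lines and their gluing\<close>

text \<open>The solution is the Green series over \<open>I\<close>. The set \<open>I\<close>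
  distributes the errors: \<open>{1..}\<close> goes to the right half-line and \<open>{..0}\<close>
  to the left, so the error arriving at time 0 is counted once. The resulting position of
  \<open>s 0\<close> relative to \<open>P 0\<close> is what the gluing needs.\<close>

lemma exp_dichotomy_bounded_solution:
  fixes A P :: "int \<Rightarrow> 'a::euclidean_space \<Rightarrow> 'a"
  assumes N: "is_norm N" and lin: "\<And>n. linear (A n)"
    and J: "0 \<in> J" "\<forall>a\<in>J. \<forall>b\<in>J. {a..b} \<subseteq> J"
    and dich: "exp_dichotomy N A J P" and I: "I \<subseteq> J"
  obtains K where "K > 0" "invariant_splitting A P J"
    "\<And>m v. m \<in> J \<Longrightarrow> N (green A P m 0 v) \<le> K * N v"
    "\<And>w \<delta>. \<delta> > 0 \<Longrightarrow> (\<And>j. N (w j) \<le> \<delta>) \<Longrightarrow>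
       \<exists>s. (\<forall>m\<in>J. N (s m) \<le> K * \<delta>) \<and>
         (\<forall>m. m \<in> J \<and> m + 1 \<in> J \<longrightarrow> s (m + 1) = A m (s m) + (if m + 1 \<in> I then w (m + 1) else 0)) \<and>
         (I \<subseteq> {1..} \<longrightarrow> P 0 (s 0) = 0) \<and> (I \<subseteq> {..0} \<longrightarrow> P 0 (s 0) = s 0)"
proof -
  obtain D \<mu> where split: "invariant_splitting A P J" and D: "D > 0" "\<mu> > 0"
    and decay: "\<And>m n v. m \<in> J \<Longrightarrow> n \<in> J \<Longrightarrow>
       N (green A P m n v) \<le> D * exp (- \<mu> * real_of_int \<bar>m - n\<bar>) * N v"
    using exp_dichotomy_green_decay[of N A J P, OF N lin J dich] by blast
  interpret invariant_splitting A P J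
    by (rule split)
  \<comment> \<open>The decay constant times the bound of \<open>sum_exp_distance_le\<close>. That
    bound is at least 1, so \<open>K\<close> also dominates \<open>G m 0\<close>.\<close>
  define K where "K = D * (2 / (1 - exp (- \<mu>)))"
  have "D * 1 \<le> K"
    unfolding K_def using D by (intro mult_left_mono) (auto simp: field_simps)
  then have K: "D \<le> K"
    by simp
  have G0: "N (G m 0 v) \<le> K * N v" if "m \<in> J" for m v
  proof -
    have "D * exp (- \<mu> * real_of_int \<bar>m - 0\<bar>) \<le> D * 1"
      using D by (intro mult_left_mono) auto
    then have "D * exp (- \<mu> * real_of_int \<bar>m - 0\<bar>) * N v \<le> K * N v"
      using K is_normD(1)[OF N, of v] by (intro mult_right_mono) auto
    then show ?thesis
      using decay[OF that J(1), of v] by linarith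
  qed
  have "\<exists>s. (\<forall>m\<in>J. N (s m) \<le> K * \<delta>) \<and>
         (\<forall>m. m \<in> J \<and> m + 1 \<in> J \<longrightarrow> s (m + 1) = A m (s m) + (if m + 1 \<in> I then w (m + 1) else 0)) \<and>
         (I \<subseteq> {1..} \<longrightarrow> P 0 (s 0) = 0) \<and> (I \<subseteq> {..0} \<longrightarrow> P 0 (s 0) = s 0)"
    if \<delta>: "\<delta> > 0" and w: "\<And>j. N (w j) \<le> \<delta>" for w \<delta>
  proof -
    have sum_le: "(\<Sum>j\<in>F. N (G m j (w j))) \<le> K * \<delta>"
      if m: "m \<in> J" and F: "finite F" "F \<subseteq> I" for F m
    proof -
      have "(\<Sum>j\<in>F. N (G m j (w j))) \<le> (\<Sum>j\<in>F. (D * \<delta>) * exp (- \<mu> * real_of_int \<bar>m - j\<bar>))"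
      proof (rule sum_mono)
        fix j assume "j \<in> F"
        then have "N (G m j (w j)) \<le> D * exp (- \<mu> * real_of_int \<bar>m - j\<bar>) * N (w j)"
          using F(2) I m by (intro decay) auto
        also have "\<dots> \<le> D * exp (- \<mu> * real_of_int \<bar>m - j\<bar>) * \<delta>"
          using D w by (intro mult_left_mono) auto
        finally show "N (G m j (w j)) \<le> (D * \<delta>) * exp (- \<mu> * real_of_int \<bar>m - j\<bar>)"
          by (simp add: mult_ac)
      qed
      also have "\<dots> = (D * \<delta>) * (\<Sum>j\<in>F. exp (- \<mu> * real_of_int \<bar>m - j\<bar>))"
        by (simp add: sum_distrib_left)
      also have "\<dots> \<le> (D * \<delta>) * (2 / (1 - exp (- \<mu>)))"
        using D \<delta> F(1) by (intro mult_left_mono sum_exp_distance_le) auto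
      finally show ?thesis
        by (simp add: K_def mult_ac)
    qed
    have "\<exists>s. ((\<lambda>j. G m j (w j)) has_sum s) I \<and> N s \<le> K * \<delta>" if "m \<in> J" for m
      using has_sum_is_norm_bounded[OF N sum_le[OF that]] by blast
    then obtain s where s: "\<And>m. m \<in> J \<Longrightarrow> ((\<lambda>j. G m j (w j)) has_sum s m) I"
      "\<And>m. m \<in> J \<Longrightarrow> N (s m) \<le> K * \<delta>"
      by metis
    have step: "s (m + 1) = A m (s m) + (if m + 1 \<in> I then w (m + 1) else 0)"
      if m: "m \<in> J" "m + 1 \<in> J" for m
    proof -
      \<comment> \<open>A linear map in finite dimension is continuous and passes through the
        infinite sum.\<close>
      have "((\<lambda>j. A m (G m j (w j))) has_sum A m (s m)) I"
        by (rule has_sum_bounded_linear[OF linear_conv_bounded_linear[THEN iffD1, OF lin] s(1)[OF m(1)]])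
      moreover have "((\<lambda>j. if m + 1 = j then w j else 0) has_sum (if m + 1 \<in> I then w (m + 1) else 0)) I"
        by (rule has_sum_finite_neutralI[of "I \<inter> {m + 1}"]) auto
      ultimately have "((\<lambda>j. A m (G m j (w j)) + (if m + 1 = j then w j else 0)) has_sum
          (A m (s m) + (if m + 1 \<in> I then w (m + 1) else 0))) I"
        by (rule has_sum_add)
      then have "((\<lambda>j. G (m + 1) j (w j)) has_sum
          (A m (s m) + (if m + 1 \<in> I then w (m + 1) else 0))) I"
        using I m by (subst has_sum_cong[OF G_step]) auto
      then show ?thesis
        using s(1)[OF m(2)] has_sum_unique by blast
    qed
    have P0: "((\<lambda>j. P 0 (G 0 j (w j))) has_sum P 0 (s 0)) I"
      by (rule has_sum_bounded_linear[OF
            linear_conv_bounded_linear[THEN iffD1, OF linear_P[OF J(1)]] s(1)[OF J(1)]])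
    have "P 0 (s 0) = 0" if "I \<subseteq> {1..}"
    proof (rule has_sum_unique[OF P0 has_sum_0])
      show "P 0 (G 0 j (w j)) = 0" if "j \<in> I" for j
        using that I \<open>I \<subseteq> {1..}\<close> J(1) by (intro G_backward(1)) force+
    qed
    moreover have "P 0 (s 0) = s 0" if "I \<subseteq> {..0}"
    proof (rule has_sum_unique[OF P0])
      have "P 0 (G 0 j (w j)) = G 0 j (w j)" if "j \<in> I" for j
        using that I \<open>I \<subseteq> {..0}\<close> J(1) by (intro P_G_forward) auto
      then show "((\<lambda>j. P 0 (G 0 j (w j))) has_sum s 0) I"
        using s(1)[OF J(1)] has_sum_cong by force
    qed
    ultimately show ?thesis
      using s(2) step by blast
  qed
  moreover have "K > 0"
    using D K by linarith
  ultimately show ?thesis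
    using that split G0 by blast
qed

lemma exp_trichotomy_imp_hyers_ulam_stable:
  fixes A :: "int \<Rightarrow> 'a::euclidean_space \<Rightarrow> 'a"
  assumes N: "is_norm N" and lin: "\<And>n. linear (A n)" and "exp_trichotomy N A"
  shows "hyers_ulam_stable N A"
proof -
  obtain Pp Pm where dp: "exp_dichotomy N A {0..} Pp" and dm: "exp_dichotomy N A {..0} Pm"
    and PP: "Pm 0 = Pm 0 \<circ> Pp 0" "Pm 0 \<circ> Pp 0 = Pp 0 \<circ> Pm 0"
    using assms(3) unfolding exp_trichotomy_def by blast
  obtain Kp where Kp: "Kp > 0" and split_p: "invariant_splitting A Pp {0..}"
    and Gp: "\<And>m v. m \<ge> 0 \<Longrightarrow> N (green A Pp m 0 v) \<le> Kp * N v"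
    and sol_p: "\<And>w \<delta>. \<delta> > 0 \<Longrightarrow> (\<And>j. N (w j) \<le> \<delta>) \<Longrightarrow>
      \<exists>s. (\<forall>m\<ge>0. N (s m) \<le> Kp * \<delta>) \<and> 
        (\<forall>m. 0 \<le> m \<and> 0 \<le> m + 1 \<longrightarrow> s (m + 1) = A m (s m) + w (m + 1)) \<and> Pp 0 (s 0) = 0"
    by (rule exp_dichotomy_bounded_solution[of N A "{0..}" Pp "{1..}", OF N lin _ _ dp])
      (auto simp: Ball_def)
  obtain Km where Km: "Km > 0" and split_m: "invariant_splitting A Pm {..0}"
    and Gm: "\<And>m v. m \<le> 0 \<Longrightarrow> N (green A Pm m 0 v) \<le> Km * N v"
    and sol_m: "\<And>w \<delta>. \<delta> > 0 \<Longrightarrow> (\<And>j. N (w j) \<le> \<delta>) \<Longrightarrow>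
      \<exists>s. (\<forall>m\<le>0. N (s m) \<le> Km * \<delta>) \<and> 
        (\<forall>m. m \<le> 0 \<and> m + 1 \<le> 0 \<longrightarrow> s (m + 1) = A m (s m) + w (m + 1)) \<and> Pm 0 (s 0) = s 0"
    by (rule exp_dichotomy_bounded_solution[of N A "{..0}" Pm "{..0}", OF N lin _ _ dm])
      (auto simp: Ball_def)
  interpret p: invariant_splitting A Pp "{0..}"
    by (rule split_p)
  interpret m: invariant_splitting A Pm "{..0}"
    by (rule split_m)
  \<comment> \<open>The first and third terms bound the correction for \<open>n \<ge> 0\<close>, the
    second and fourth for \<open>n < 0\<close>.\<close>
  let ?L = "Kp + Km + Kp * Km + Km * Kp"
  have "\<exists>x. is_solution A x \<and> (\<forall>n. N (x n - y n) \<le> ?L * \<delta>)"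
    if \<delta>: "\<delta> > 0" and y: "\<And>n. N (y (n + 1) - A n (y n)) \<le> \<delta>" for \<delta> y
  proof -
    \<comment> \<open>Errors are indexed by the time at which they arrive, matching the jump of the
      Green function.\<close>
    define w where "w j = y j - A (j - 1) (y (j - 1))" for j
    have w: "N (w j) \<le> \<delta>" for j
      using y[of "j - 1"] by (simp add: w_def)
    obtain sp where sp: "\<And>m. m \<ge> 0 \<Longrightarrow> N (sp m) \<le> Kp * \<delta>"
      "\<And>m. 0 \<le> m \<Longrightarrow> 0 \<le> m + 1 \<Longrightarrow> sp (m + 1) = A m (sp m) + w (m + 1)" "Pp 0 (sp 0) = 0"
      using sol_p[of \<delta> w, OF \<delta> w] by blast
    obtain sm where sm: "\<And>m. m \<le> 0 \<Longrightarrow> N (sm m) \<le> Km * \<delta>"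
      "\<And>m. m \<le> 0 \<Longrightarrow> m + 1 \<le> 0 \<Longrightarrow> sm (m + 1) = A m (sm m) + w (m + 1)" "Pm 0 (sm 0) = sm 0"
      using sol_m[of \<delta> w, OF \<delta> w] by blast
    \<comment> \<open>Compatibility at 0: the kernel of \<open>Pp 0\<close> lies in that of
      \<open>Pm 0\<close>, and in \<open>Pp_sm\<close> the range of \<open>Pm 0\<close> lies in that
      of \<open>Pp 0\<close>.\<close>
    have Pm_sp: "Pm 0 (sp 0) = 0"
      using fun_cong[OF PP(1), of "sp 0"] sp(3) linear_0[OF m.linear_P[of 0]] by simp
    have Pp_sm: "Pp 0 (sm 0) = sm 0"
      using fun_cong[OF PP(1), of "sm 0"] fun_cong[OF PP(2), of "sm 0"] sm(3) by simp
    \<comment> \<open>Both pieces are to meet in \<open>sp 0 + sm 0\<close> at time 0. The right one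
      receives the bounded forward orbit of \<open>sm 0\<close>; the left one receives a bounded
      backward orbit of \<open>sp 0\<close>, which is
      \<open>- green A Pm n 0 (sp 0)\<close>.\<close>
    define z where "z n = (if 0 \<le> n then sp n + green A Pp n 0 (sm 0) else sm n - green A Pm n 0 (sp 0))" for n
    have z_step: "z (n + 1) = A n (z n) + w (n + 1)" for n
    proof -
      consider "n \<ge> 0" | "n = - 1" | "n < - 1"
        by linarith
      then show ?thesis
      proof cases
        case 1
        then show ?thesis
          using sp(2)[of n] p.G_step[of n 0 "sm 0"] by (simp add: z_def linear_add[OF lin])
      next
        case 2
        have "green A Pp 0 0 (sm 0) = sm 0" "green A Pm 0 0 (sp 0) = 0"
          using Pp_sm Pm_sp by (simp_all add: p.G_forward m.G_forward)
        then have "A (- 1) (green A Pm (- 1) 0 (sp 0)) = - sp 0"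
          using m.G_step[of "- 1" 0 "sp 0"] by (simp add: eq_neg_iff_add_eq_0)
        then show ?thesis
          using 2 sm(2)[of "- 1"] \<open>green A Pp 0 0 (sm 0) = sm 0\<close>
          by (simp add: z_def linear_diff[OF lin])
      next
        case 3
        then show ?thesis
          using sm(2)[of n] m.G_step[of n 0 "sp 0"] by (simp add: z_def linear_diff[OF lin])
      qed
    qed
    have z_le: "N (z n) \<le> ?L * \<delta>" for n
    proof (cases "0 \<le> n")
      case True
      have "N (green A Pp n 0 (sm 0)) \<le> Kp * (Km * \<delta>)"
        using Kp sm(1)[of 0] by (intro order_trans[OF Gp[OF True]] mult_left_mono) auto
      then have "N (z n) \<le> Kp * \<delta> + Kp * (Km * \<delta>)"
        using True sp(1)[OF True] is_normD(4)[OF N, of "sp n" "green A Pp n 0 (sm 0)"]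
        by (simp add: z_def)
      moreover have "0 \<le> Km * \<delta> + Km * (Kp * \<delta>)"
        using Kp Km \<delta> by simp
      ultimately show ?thesis
        by (simp add: algebra_simps)
    next
      case False
      then have "n \<le> 0"
        by simp
      then have "N (green A Pm n 0 (sp 0)) \<le> Km * (Kp * \<delta>)"
        using Km sp(1)[of 0] by (intro order_trans[OF Gm] mult_left_mono) auto
      then have "N (z n) \<le> Km * \<delta> + Km * (Kp * \<delta>)"
        using False sm(1)[of n] is_norm_diff[OF N, of "sm n" "green A Pm n 0 (sp 0)"]
        by (simp add: z_def)
      moreover have "0 \<le> Kp * \<delta> + Kp * (Km * \<delta>)"
        using Kp Km \<delta> by simp
      ultimately show ?thesis
        by (simp add: algebra_simps)
    qed
    show ?thesis
    proof (intro exI conjI allI)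
      show "is_solution A (\<lambda>n. y n - z n)"
        unfolding is_solution_def using z_step by (simp add: w_def linear_diff[OF lin])
      show "N (y n - z n - y n) \<le> ?L * \<delta>" for n
        using z_le[of n] by (simp add: is_norm_minus[OF N])
    qed
  qed
  moreover have "?L > 0"
    using Kp Km by (simp add: add_pos_pos)
  ultimately show ?thesis
    unfolding hyers_ulam_stable_def by blast
qed

theorem theorem1:
  fixes N :: "real ^ 'd \<Rightarrow> real"
    and A :: "int \<Rightarrow> real ^ 'd \<Rightarrow> real ^ 'd"
  assumes "is_norm N"
    and "\<And>n. linear (A n)"
    and "\<And>x :: int \<Rightarrow> real ^ 'd.
           \<lbrakk>\<exists>M. \<forall>n\<le>0. N (x n) \<le> M; x 0 = 0; \<forall>n\<le>-1. x (n + 1) = A n (x n)\<rbrakk>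
           \<Longrightarrow> \<forall>n\<le>0. x n = 0"
  shows "hyers_ulam_stable N A \<longleftrightarrow> exp_trichotomy N A"
proof
  assume "hyers_ulam_stable N A"
  then show "exp_trichotomy N A"
    using assms by (intro hyers_ulam_stable_imp_exp_trichotomy)
next
  assume "exp_trichotomy N A"
  then show "hyers_ulam_stable N A"
    using assms(1,2) by (intro exp_trichotomy_imp_hyers_ulam_stable)
qed

end
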